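(* Let $V$ be a simple Euclidean Jordan algebra of rank at least $3$, with cone of squares $Q$. Then in $(V,Q)$ there is no proper closed convex lattice-like set with nonempty interior. In particular, for $n\ge 3$, let $\mathbb{S}^n$ be the space of real symmetric $n\times n$ matrices and $\mathbb{S}^n_+\subset\mathbb{S}^n$ the cone of positive semidefinite matrices; then $(\mathbb{S}^n,\mathbb{S}^n_+)$ contains no proper closed convex lattice-like set with nonempty interior.
   Context: A Euclidean Jordan algebra $V$ is a finite-dimensional real vector space with a commutative bilinear product $(x,y)\mapsto xy$ satisfying $x^2(xy)=x(x^2y)$, with a unit element $e$, and with an inner product $\langle\cdot,\cdot\rangle$ such that $\langle xy,z\rangle=\langle y,xz\rangle$ for all $x,y,z\in V$. Its cone of squares is $Q=\{x^2: x\in V\}$, a closed convex self-dual cone. $V$ is simple if it contains no nontrivial ideal. The rank of $V$ is the common number $r$ of elements of its Jordan frames, a Jordan frame being a set $\{c_1,\dots,c_r\}$ of primitive idempotents with $c_ic_j=0$ for $i\ne j$ and $c_1+\dots+c_r=e$. For a Euclidean space $E$, a closed convex cone $K\subset E$, and $x,y\in E$, put $x\sqcap_K y=P_{x-K}\,y$ and $x\sqcup_K y=P_{x+K}\,y$, where $P_D$ denotes the metric (nearest point) projection onto a nonempty closed convex set $D$. A set $M\subset E$ is lattice-like in $(E,K)$ if $x\sqcap_K y\in M$ and $x\sqcup_K y\in M$ for all $x,y\in M$. Proper means different from the whole space. $\mathbb{S}^n$ carries the trace inner product $\langle A,B\rangle=\operatorname{tr}(AB)$. *)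

theory Defs
  imports "HOL-Analysis.Analysis"
begin

section \<open>Lattice-like sets\<close>

text \<open>The metric projection onto a nonempty closed convex set is \<^const>\<open>closest_point\<close>.\<close>

definition cone_inf :: "'a::euclidean_space set \<Rightarrow> 'a \<Rightarrow> 'a \<Rightarrow> 'a" where
  "cone_inf K x y = closest_point ((\<lambda>k. x - k) ` K) y"

definition cone_sup :: "'a::euclidean_space set \<Rightarrow> 'a \<Rightarrow> 'a \<Rightarrow> 'a" where
  "cone_sup K x y = closest_point ((\<lambda>k. x + k) ` K) y"

text \<open>
  If the cone \<open>K\<close> lies in a subspace \<open>E\<close> of the ambient type and \<open>x, y\<close> are in \<open>E\<close>, then
  \<open>x - K\<close> and \<open>x + K\<close> lie in \<open>E\<close> as well, so these projections are the ones taken inside \<open>E\<close>.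
  The same definitions therefore serve for a Euclidean space given as such a subspace.
\<close>

definition lattice_like :: "'a::euclidean_space set \<Rightarrow> 'a set \<Rightarrow> bool" where
  "lattice_like K M \<longleftrightarrow> (\<forall>x\<in>M. \<forall>y\<in>M. cone_inf K x y \<in> M \<and> cone_sup K x y \<in> M)"


section \<open>Euclidean Jordan algebras\<close>

text \<open>The inner product of the algebra is the one of the type class.\<close>

locale euclidean_jordan_algebra =
  fixes jp :: "'a::euclidean_space \<Rightarrow> 'a \<Rightarrow> 'a"
    and e :: 'a
  assumes bilinear: "bilinear jp"
    and commute: "jp x y = jp y x"
    and jordan: "jp (jp x x) (jp x y) = jp x (jp (jp x x) y)"
    and unit: "jp e x = x"
    and inner_assoc: "jp x y \<bullet> z = y \<bullet> jp x z"

definition cone_of_squares :: "('a \<Rightarrow> 'a \<Rightarrow> 'a) \<Rightarrow> 'a set" where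
  "cone_of_squares jp = range (\<lambda>x. jp x x)"

definition jordan_ideal :: "('a::euclidean_space \<Rightarrow> 'a \<Rightarrow> 'a) \<Rightarrow> 'a set \<Rightarrow> bool" where
  "jordan_ideal jp I \<longleftrightarrow> subspace I \<and> (\<forall>x. \<forall>y\<in>I. jp x y \<in> I)"

definition jordan_simple :: "('a::euclidean_space \<Rightarrow> 'a \<Rightarrow> 'a) \<Rightarrow> bool" where
  "jordan_simple jp \<longleftrightarrow> (\<forall>I. jordan_ideal jp I \<longrightarrow> I = {0} \<or> I = UNIV)"

definition idempotent :: "('a \<Rightarrow> 'a \<Rightarrow> 'a) \<Rightarrow> 'a \<Rightarrow> bool" where
  "idempotent jp c \<longleftrightarrow> jp c c = c"

text \<open>
  If \<open>a\<close>, \<open>b\<close> and \<open>a + b\<close> are idempotent, then \<open>a\<close> and \<open>b\<close> are automatically orthogonal,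
  i.e. \<open>jp a b = 0\<close>.
\<close>

definition primitive_idempotent :: "('a::euclidean_space \<Rightarrow> 'a \<Rightarrow> 'a) \<Rightarrow> 'a \<Rightarrow> bool" where
  "primitive_idempotent jp c \<longleftrightarrow>
     idempotent jp c \<and> c \<noteq> 0 \<and>
     \<not> (\<exists>a b. idempotent jp a \<and> a \<noteq> 0 \<and> idempotent jp b \<and> b \<noteq> 0 \<and> c = a + b)"

definition jordan_frame :: "('a::euclidean_space \<Rightarrow> 'a \<Rightarrow> 'a) \<Rightarrow> 'a \<Rightarrow> 'a set \<Rightarrow> bool" where
  "jordan_frame jp e C \<longleftrightarrow>
     finite C \<and> (\<forall>c\<in>C. primitive_idempotent jp c) \<and>
     (\<forall>c\<in>C. \<forall>d\<in>C. c \<noteq> d \<longrightarrow> jp c d = 0) \<and> \<Sum>C = e"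

text \<open>
  Jordan frames exist in every Euclidean Jordan algebra and all have the same number of elements,
  so the choice is immaterial.
\<close>

definition jordan_rank :: "('a::euclidean_space \<Rightarrow> 'a \<Rightarrow> 'a) \<Rightarrow> 'a \<Rightarrow> nat" where
  "jordan_rank jp e = card (SOME C. jordan_frame jp e C)"


section \<open>Symmetric matrices\<close>

definition sym_matrices :: "(real ^ 'n ^ 'n) set" where
  "sym_matrices = {A. transpose A = A}"

definition psd_matrices :: "(real ^ 'n ^ 'n) set" where
  "psd_matrices = {A \<in> sym_matrices. \<forall>x. 0 \<le> x \<bullet> (A *v x)}"

text \<open>On symmetric matrices the inner product of the matrix type is the trace inner product.\<close>

lemma inner_sym_matrices:
  assumes "A \<in> sym_matrices"
  shows "A \<bullet> B = trace (A ** B)"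
proof -
  have "A $ i $ j = A $ j $ i" for i j
    using assms by (metis (mono_tags, lifting) mem_Collect_eq sym_matrices_def transpose_def vec_lambda_beta)
  then have "A \<bullet> B = (\<Sum>i\<in>UNIV. \<Sum>j\<in>UNIV. A $ j $ i * B $ i $ j)"
    by (simp add: inner_vec_def)
  also have "\<dots> = (\<Sum>j\<in>UNIV. \<Sum>i\<in>UNIV. A $ j $ i * B $ i $ j)"
    by (rule sum.swap)
  also have "\<dots> = trace (A ** B)"
    by (simp add: trace_def matrix_matrix_mult_def)
  finally show ?thesis .
qed

end

theory Submission
  imports Defs
begin

text \<open>
  At a smooth boundary point of a lattice-like set \<open>M\<close>, the functional \<open>f\<close> of the supporting
  hyperplane satisfies \<open>f u * f v \<le> 0\<close> for orthogonal \<open>u, v\<close> in the cone: otherwise two points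
  of \<open>M\<close> near the boundary differ by multiples of \<open>u - v\<close> in such a way that one of the two
  lattice operations leaves the half space. Three pairwise products of nonzero reals cannot all
  be negative, so in rank at least 3 some idempotent of a Jordan frame has \<open>f = 0\<close>. If \<open>f\<close> does
  not vanish on an idempotent \<open>c\<close> of the frame, then rotating \<open>c\<close> towards an idempotent \<open>d\<close>
  with \<open>f d = 0\<close> linked to \<open>c\<close> by a Peirce space gives orthogonal idempotents on which \<open>f\<close> has
  the same sign. Simplicity supplies the links. Hence \<open>f\<close> vanishes on all frames, also the
  rotated ones, and therefore on all Peirce spaces.
\<close>

section \<open>Supporting hyperplanes of lattice-like sets\<close>

lemma closest_point_eqI:
  assumes "b \<in> S" and "\<And>y. y \<in> S \<Longrightarrow> y \<noteq> b \<Longrightarrow> dist a b < dist a y"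
  shows "closest_point S a = b"
  unfolding closest_point_def
proof (rule some_equality)
  show "b \<in> S \<and> (\<forall>y\<in>S. dist a b \<le> dist a y)"
    using assms by (metis order.refl less_imp_le)
next
  fix x assume "x \<in> S \<and> (\<forall>y\<in>S. dist a x \<le> dist a y)"
  then show "x = b"
    using assms by (meson not_le)
qed

lemma norm_less_norm_add:
  fixes u v :: "'a::real_inner"
  assumes "u \<noteq> 0" "0 \<le> u \<bullet> v"
  shows "norm v < norm (u + v)"
proof -
  have "norm v ^ 2 < norm (u + v) ^ 2"
    using assms
    by (simp add: power2_norm_eq_inner inner_add inner_commute add_nonneg_pos)
  then show ?thesis
    by (rule power_less_imp_less_base) simp
qed

text \<open>Moreau's decomposition: as \<open>u\<close> lies in \<open>K\<close>, \<open>v\<close>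
  in the dual cone and \<open>u \<bullet> v = 0\<close>, the point of \<open>K\<close> nearest to
  \<open>u - v\<close> is \<open>u\<close>; everything is translated by \<open>x\<close>.\<close>

lemma cone_sup_orthogonal:
  assumes "u \<in> K" "u \<bullet> v = 0" "\<And>w. w \<in> K \<Longrightarrow> 0 \<le> w \<bullet> v"
  shows "cone_sup K x (x + u - v) = x + u"
  unfolding cone_sup_def
proof (rule closest_point_eqI)
  fix y assume "y \<in> (\<lambda>k. x + k) ` K" "y \<noteq> x + u"
  then obtain w where w: "w \<in> K" "y = x + w" "w - u \<noteq> 0" by auto
  have "norm v < norm ((w - u) + v)"
    using w assms by (intro norm_less_norm_add) (auto simp: inner_diff_left)
  then show "dist (x + u - v) (x + u) < dist (x + u - v) y"
    using w by (simp add: dist_norm norm_minus_commute algebra_simps)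
qed (use assms in auto)

text \<open>The mirror image: seen from \<open>x\<close>, the point of \<open>- K\<close> nearest to
  \<open>u - v\<close> is \<open>- v\<close>.\<close>

lemma cone_inf_orthogonal:
  assumes "v \<in> K" "u \<bullet> v = 0" "\<And>w. w \<in> K \<Longrightarrow> 0 \<le> w \<bullet> u"
  shows "cone_inf K x (x + u - v) = x - v"
  unfolding cone_inf_def
proof (rule closest_point_eqI)
  fix y assume "y \<in> (\<lambda>k. x - k) ` K" "y \<noteq> x - v"
  then obtain w where w: "w \<in> K" "y = x - w" "w - v \<noteq> 0" by auto
  have "norm u < norm ((w - v) + u)"
    using w assms by (intro norm_less_norm_add) (auto simp: inner_diff_left inner_commute[of v])
  then show "dist (x + u - v) (x - v) < dist (x + u - v) y"
    unfolding w(2) by (simp add: dist_norm norm_minus_commute algebra_simps)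
qed (use assms in auto)

text \<open>
  The boundary point nearest to a fixed interior point is smooth, because a ball inside \<open>M\<close>
  touches the boundary there.
\<close>

lemma smooth_boundary_point:
  fixes M S :: "'a::euclidean_space set"
  assumes "subspace S" "M \<subseteq> S" "M \<noteq> S" "closed M" "convex M"
    and "top_of_set S interior_of M \<noteq> {}"
  obtains m a where "m \<in> S" "a \<in> S" "a \<noteq> 0"
    and "\<And>x. x \<in> M \<Longrightarrow> a \<bullet> (x - m) \<le> 0"
    and "\<And>d. d \<in> S \<Longrightarrow> a \<bullet> d < 0 \<Longrightarrow> \<exists>r>0. \<forall>t. 0 < t \<longrightarrow> t \<le> r \<longrightarrow> m + t *\<^sub>R d \<in> M"
proof -
  obtain p U where pU: "openin (top_of_set S) U" "p \<in> U" "U \<subseteq> M"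
    using assms(6) unfolding interior_of_def by auto
  then have pS: "p \<in> S" using assms(2) by auto
  obtain \<epsilon> where \<epsilon>: "\<epsilon> > 0" "ball p \<epsilon> \<inter> S \<subseteq> U"
    using pU by (meson openin_contains_ball)
  \<comment> \<open>The point \<open>m\<close> of \<open>N\<close> nearest to \<open>p\<close> has
    the property that the open ball of \<open>S\<close> around \<open>p\<close> with
    \<open>m\<close> on its sphere lies in \<open>M\<close>.\<close>
  define N where "N = closure (S - M)"
  have "N \<noteq> {}" "closed N"
    using assms(2,3) by (auto simp: N_def)
  then obtain m where m: "m \<in> N" "\<And>y. y \<in> N \<Longrightarrow> dist p m \<le> dist p y"
    using distance_attains_inf by metis
  have mS: "m \<in> S"
    using m(1) closure_minimal[of "S - M" S] closed_subspace[OF assms(1)] by (auto simp: N_def)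
  have near: "\<exists>z\<in>S - M. dist z m < \<delta>" if "\<delta> > 0" for \<delta>
    using m(1) that unfolding N_def closure_approachable by auto
  have "\<not> dist p m < \<epsilon>"
  proof
    assume "dist p m < \<epsilon>"
    then obtain z where "z \<in> S - M" "dist z m < \<epsilon> - dist p m"
      using near[of "\<epsilon> - dist p m"] by auto
    then have "dist p z < \<epsilon>"
      using dist_triangle[of p z m] by (simp add: dist_commute)
    then show False
      using \<open>z \<in> S - M\<close> \<epsilon> pU by auto
  qed
  then have R: "dist p m > 0" using \<epsilon> by linarith
  have ball: "x \<in> M" if "x \<in> S" "dist p x < dist p m" for x
    using m(2)[of x] that closure_subset[of "S - M"] by (auto simp: N_def)
  define a where "a = m - p"
  have aS: "a \<in> S" "a \<noteq> 0"
    using R mS pS assms(1) by (auto simp: a_def subspace_diff)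
  have inside: "\<exists>r>0. \<forall>t. 0 < t \<longrightarrow> t \<le> r \<longrightarrow> m + t *\<^sub>R d \<in> S \<and> dist p (m + t *\<^sub>R d) < dist p m"
    if d: "d \<in> S" "a \<bullet> d < 0" for d
  proof (intro exI[of _ "- (a \<bullet> d) / (norm d)\<^sup>2"] conjI allI impI)
    have "d \<noteq> 0" using d by auto
    then show "- (a \<bullet> d) / (norm d)\<^sup>2 > 0" using d by (simp add: divide_neg_pos)
    fix t :: real assume t: "0 < t" "t \<le> - (a \<bullet> d) / (norm d)\<^sup>2"
    have td: "t * (norm d)\<^sup>2 \<le> - (a \<bullet> d)"
      using t \<open>d \<noteq> 0\<close> by (simp add: field_simps)
    show "m + t *\<^sub>R d \<in> S"
      using mS d assms(1) by (simp add: subspace_add subspace_scale)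
    \<comment> \<open>The bound \<open>td\<close> makes the bracket on the right at most
      \<open>a \<bullet> d\<close>, hence negative.\<close>
    have "(norm (a + t *\<^sub>R d))\<^sup>2 = (norm a)\<^sup>2 + t * (2 * (a \<bullet> d) + t * (norm d)\<^sup>2)"
      unfolding power2_norm_eq_inner by (simp add: inner_add inner_commute algebra_simps)
    also have "\<dots> < (norm a)\<^sup>2"
      using t td d by (simp add: mult_less_0_iff)
    finally have "norm (a + t *\<^sub>R d) < norm a"
      by (rule power_less_imp_less_base) simp
    then show "dist p (m + t *\<^sub>R d) < dist p m"
      by (simp add: a_def dist_norm norm_minus_commute algebra_simps)
  qed
  have outside: "a \<bullet> (x - m) \<le> 0" if x: "x \<in> M" for x
  proof (rule ccontr)
    \<comment> \<open>Prolonging the segment from \<open>x\<close> to \<open>m\<close> beyond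
      \<open>m\<close> reaches a point \<open>q\<close> of the ball. The dilation with centre
      \<open>x\<close> and factor \<open>1 + t\<close> maps \<open>m\<close> to \<open>q\<close>,
      and a point \<open>z\<close> outside \<open>M\<close> close to \<open>m\<close> to a point
      \<open>y\<close> still in the ball. Then \<open>z\<close> is a convex combination of
      \<open>x\<close> and \<open>y\<close>, both in \<open>M\<close>.\<close>
    assume "\<not> a \<bullet> (x - m) \<le> 0"
    then have "a \<bullet> (m - x) < 0" by (simp add: inner_diff_right)
    moreover have xS: "x \<in> S" using x assms by auto
    then have "m - x \<in> S" using mS assms(1) by (simp add: subspace_diff)
    ultimately obtain t where t: "t > 0" "dist p (m + t *\<^sub>R (m - x)) < dist p m"
      using inside[of "m - x"] by auto
    define q where "q = m + t *\<^sub>R (m - x)"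
    define \<delta> where "\<delta> = dist p m - dist p q"
    have "\<delta> / (1 + t) > 0" using t by (simp add: \<delta>_def q_def)
    then obtain z where z: "z \<in> S - M" "dist z m < \<delta> / (1 + t)"
      using near by blast
    define y where "y = (1 + t) *\<^sub>R z - t *\<^sub>R x"
    have "y - q = (1 + t) *\<^sub>R (z - m)"
      by (simp add: y_def q_def algebra_simps)
    then have "dist q y = (1 + t) * dist z m"
      using t by (simp add: dist_norm norm_minus_commute[of q])
    also have "\<dots> < \<delta>"
      using z t by (simp add: field_simps)
    finally have "dist p y < dist p m"
      using dist_triangle[of p y q] by (simp add: \<delta>_def dist_commute)
    moreover have "y \<in> S"
      using z xS assms(1) by (simp add: y_def subspace_diff subspace_scale)
    ultimately have "y \<in> M" using ball by blast
    then have "(1 / (1 + t)) *\<^sub>R y + (t / (1 + t)) *\<^sub>R x \<in> M"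
      using x t assms(5) by (intro convexD) (auto simp: field_simps)
    moreover have "(1 / (1 + t)) *\<^sub>R y + (t / (1 + t)) *\<^sub>R x = z"
      using t by (simp add: y_def scaleR_diff_right)
    ultimately show False using z by auto
  qed
  show thesis
  proof (rule that[OF mS aS])
    fix d assume "d \<in> S" "a \<bullet> d < 0"
    from inside[OF this] show "\<exists>r>0. \<forall>t. 0 < t \<longrightarrow> t \<le> r \<longrightarrow> m + t *\<^sub>R d \<in> M"
      using ball by blast
  qed (rule outside)
qed

text \<open>\<open>a\<close> is the outer normal at a smooth boundary point. Working relative to a
  subspace \<open>S\<close> serves both the whole algebra and the symmetric matrices. Membership of
  \<open>u\<close> and \<open>v\<close> in the dual cone is a premise, checked later directly for
  idempotents and rank-one matrices.\<close>

lemma lattice_like_normal: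
  fixes M S K :: "'a::euclidean_space set"
  assumes S: "subspace S" and MS: "M \<subseteq> S" "M \<noteq> S" and M: "closed M" "convex M"
    and "top_of_set S interior_of M \<noteq> {}"
    and K: "K \<subseteq> S" "cone K" and latt: "lattice_like K M"
  obtains a where "a \<in> S" "a \<noteq> 0"
    and "\<And>u v. \<lbrakk>u \<in> K; v \<in> K; u \<bullet> v = 0; \<And>w. w \<in> K \<Longrightarrow> 0 \<le> w \<bullet> u; \<And>w. w \<in> K \<Longrightarrow> 0 \<le> w \<bullet> v\<rbrakk>
           \<Longrightarrow> (a \<bullet> u) * (a \<bullet> v) \<le> 0"
proof -
  obtain m a where m: "m \<in> S" and a: "a \<in> S" "a \<noteq> 0"
    and outside: "\<And>x. x \<in> M \<Longrightarrow> a \<bullet> (x - m) \<le> 0"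
    and inside: "\<And>d. d \<in> S \<Longrightarrow> a \<bullet> d < 0 \<Longrightarrow> \<exists>r>0. \<forall>t. 0 < t \<longrightarrow> t \<le> r \<longrightarrow> m + t *\<^sub>R d \<in> M"
    using smooth_boundary_point[OF assms(1-6)] by metis
  have two: "\<exists>t>0. m + t *\<^sub>R d \<in> M \<and> m + t *\<^sub>R d' \<in> M"
    if "d \<in> S" "d' \<in> S" "a \<bullet> d < 0" "a \<bullet> d' < 0" for d d'
  proof -
    obtain r r' where "r > 0" "\<forall>t. 0 < t \<longrightarrow> t \<le> r \<longrightarrow> m + t *\<^sub>R d \<in> M"
      "r' > 0" "\<forall>t. 0 < t \<longrightarrow> t \<le> r' \<longrightarrow> m + t *\<^sub>R d' \<in> M"
      using inside[OF \<open>d \<in> S\<close>] inside[OF \<open>d' \<in> S\<close>] \<open>a \<bullet> d < 0\<close> \<open>a \<bullet> d' < 0\<close> by metis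
    then show ?thesis by (intro exI[of _ "min r r'"]) auto
  qed
  have "(a \<bullet> u) * (a \<bullet> v) \<le> 0"
    if uv: "u \<in> K" "v \<in> K" "u \<bullet> v = 0"
      and pu: "\<And>w. w \<in> K \<Longrightarrow> 0 \<le> w \<bullet> u" and pv: "\<And>w. w \<in> K \<Longrightarrow> 0 \<le> w \<bullet> v" for u v
  proof (rule ccontr)
    assume "\<not> (a \<bullet> u) * (a \<bullet> v) \<le> 0"
    then have pos: "(a \<bullet> u) * (a \<bullet> v) > 0" by simp
    \<comment> \<open>Rescaling makes the values of \<open>a\<close> on both vectors
      \<open>1\<close> or both \<open>-1\<close>.\<close>
    define U where "U = (1 / \<bar>a \<bullet> u\<bar>) *\<^sub>R u"
    define V where "V = (1 / \<bar>a \<bullet> v\<bar>) *\<^sub>R v"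
    have UVK: "t *\<^sub>R U \<in> K" "t *\<^sub>R V \<in> K" if "t \<ge> 0" for t
      using that uv K(2) by (auto simp: U_def V_def cone_def)
    have UVS: "U \<in> S" "V \<in> S"
      using UVK[of 1] K(1) by auto
    have orth: "(t *\<^sub>R U) \<bullet> (t *\<^sub>R V) = 0" for t
      using uv by (simp add: U_def V_def)
    have nonneg: "0 \<le> w \<bullet> (t *\<^sub>R U)" "0 \<le> w \<bullet> (t *\<^sub>R V)" if "w \<in> K" "t \<ge> 0" for w t
      using that pu pv by (auto simp: U_def V_def)
    consider "a \<bullet> u > 0" "a \<bullet> v > 0" | "a \<bullet> u < 0" "a \<bullet> v < 0"
      using pos by (auto simp: zero_less_mult_iff)
    then show False
    proof cases
      case 1
      then have aUV: "a \<bullet> U = 1" "a \<bullet> V = 1" by (auto simp: U_def V_def)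
      \<comment> \<open>Relative to \<open>m\<close> both points have value \<open>- t / 2\<close>,
        so they lie in \<open>M\<close> for small \<open>t\<close>. Their supremum
        \<open>m + (t / 2) U\<close> has value \<open>t / 2\<close> and leaves the half
        space.\<close>
      obtain t where t: "t > 0" "m + t *\<^sub>R (- (1/2) *\<^sub>R U) \<in> M" "m + t *\<^sub>R ((1/2) *\<^sub>R U - V) \<in> M"
        using two[of "- (1/2) *\<^sub>R U" "(1/2) *\<^sub>R U - V"] UVS aUV S
        by (auto simp: subspace_diff subspace_scale subspace_neg inner_diff_right)
      define x where "x = m + t *\<^sub>R (- (1/2) *\<^sub>R U)"
      have "m + t *\<^sub>R ((1/2) *\<^sub>R U - V) = x + t *\<^sub>R U - t *\<^sub>R V"
        by (simp add: x_def algebra_simps flip: scaleR_add_left)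
      moreover have "cone_sup K x (x + t *\<^sub>R U - t *\<^sub>R V) = x + t *\<^sub>R U"
        using UVK t orth nonneg by (intro cone_sup_orthogonal) auto
      ultimately have "x + t *\<^sub>R U \<in> M"
        using latt t(2,3) unfolding lattice_like_def x_def by metis
      from outside[OF this] show False
        using t(1) aUV by (simp add: x_def inner_diff_right inner_add_right)
    next
      case 2
      then have aUV: "a \<bullet> U = -1" "a \<bullet> V = -1" by (auto simp: U_def V_def)
      \<comment> \<open>Again both values are \<open>- t / 2\<close>; now the infimum
        \<open>m - (t / 2) V\<close> has value \<open>t / 2\<close>.\<close>
      obtain t where t: "t > 0" "m + t *\<^sub>R ((1/2) *\<^sub>R V) \<in> M" "m + t *\<^sub>R (U - (1/2) *\<^sub>R V) \<in> M"
        using two[of "(1/2) *\<^sub>R V" "U - (1/2) *\<^sub>R V"] UVS aUV S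
        by (auto simp: subspace_diff subspace_scale subspace_neg inner_diff_right)
      define x where "x = m + t *\<^sub>R ((1/2) *\<^sub>R V)"
      have "m + t *\<^sub>R (U - (1/2) *\<^sub>R V) = x + t *\<^sub>R U - t *\<^sub>R V"
        by (simp add: x_def algebra_simps flip: scaleR_add_left)
      moreover have "cone_inf K x (x + t *\<^sub>R U - t *\<^sub>R V) = x - t *\<^sub>R V"
        using UVK t orth nonneg by (intro cone_inf_orthogonal) auto
      ultimately have "x - t *\<^sub>R V \<in> M"
        using latt t(2,3) unfolding lattice_like_def x_def by metis
      from outside[OF this] show False
        using t(1) aUV by (simp add: x_def inner_diff_right inner_add_right)
    qed
  qed
  then show thesis using that a by blast
qed

text \<open>
  The two factors are the values of a linear functional on a pair of orthogonal idempotents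
  rotated by the angle \<open>arctan s\<close>, up to the common factor \<open>1 + s\<^sup>2\<close>.
\<close>

lemma rotation_sign_change:
  fixes \<alpha> \<beta> :: real
  assumes "\<And>s. (\<alpha> + s * \<beta>) * (s\<^sup>2 * \<alpha> - s * \<beta>) \<le> 0"
  shows "\<alpha> = 0"
proof (rule ccontr)
  assume \<alpha>: "\<alpha> \<noteq> 0"
  show False
  proof (cases "\<beta> = 0")
    case True
    then show False using assms[of 1] \<alpha> by (auto simp: mult_le_0_iff)
  next
    case False
    \<comment> \<open>This \<open>s\<close> turns the first factor into \<open>\<alpha> / 2\<close>
      and the second into \<open>\<alpha> / 2 + \<alpha>^3 / (4 * \<beta>^2)\<close>, which has the
      same sign.\<close>
    have "(\<alpha> + (-\<alpha>/(2*\<beta>)) * \<beta>) * ((-\<alpha>/(2*\<beta>))\<^sup>2 * \<alpha> - (-\<alpha>/(2*\<beta>)) * \<beta>)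
        = \<alpha>\<^sup>2 / 4 * (1 + \<alpha>\<^sup>2 / (2 * \<beta>\<^sup>2))"
      using False by (simp add: field_simps power2_eq_square)
    moreover have "\<dots> > 0"
      using \<alpha> by (intro mult_pos_pos add_pos_nonneg) auto
    ultimately show False using assms[of "-\<alpha>/(2*\<beta>)"] by linarith
  qed
qed

section \<open>Symmetric matrices\<close>

text \<open>For \<open>x \<noteq> 0\<close> a positive multiple of a primitive idempotent of the
  Jordan algebra of symmetric matrices.\<close>

definition outer :: "real ^ 'n \<Rightarrow> real ^ 'n ^ 'n" where
  "outer x = (\<chi> i j. x $ i * x $ j)"

lemma inner_outer: "A \<bullet> outer x = x \<bullet> (A *v x)"
  by (simp add: outer_def inner_vec_def matrix_vector_mult_def sum_distrib_left mult_ac)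

lemma inner_outer_outer: "outer x \<bullet> outer y = (x \<bullet> y)\<^sup>2"
  by (simp add: outer_def inner_vec_def power2_eq_square sum_product mult_ac)

lemma outer_psd: "outer x \<in> psd_matrices"
proof -
  have "outer x *v y = (x \<bullet> y) *\<^sub>R x" for y
    by (simp add: outer_def matrix_vector_mult_def vec_eq_iff inner_vec_def
        sum_distrib_left sum_distrib_right mult_ac)
  then have "0 \<le> y \<bullet> (outer x *v y)" for y
    by (simp add: inner_commute)
  moreover have "outer x \<in> sym_matrices"
    by (simp add: sym_matrices_def transpose_def outer_def vec_eq_iff mult.commute)
  ultimately show ?thesis by (simp add: psd_matrices_def)
qed

lemma subspace_sym_matrices: "subspace sym_matrices"
  by (auto simp: subspace_def sym_matrices_def transpose_def vec_eq_iff)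

lemma cone_psd_matrices: "cone psd_matrices"
  using subspace_scale[OF subspace_sym_matrices]
  by (auto simp: cone_def psd_matrices_def simp flip: scaleR_matrix_vector_assoc)

lemma sym_matrix_inner_commute:
  assumes "A \<in> sym_matrices"
  shows "x \<bullet> (A *v y) = y \<bullet> (A *v x)"
  using assms by (metis (mono_tags, lifting) dot_lmul_matrix inner_commute mem_Collect_eq
      sym_matrices_def transpose_matrix_vector)

text \<open>The quadratic form of \<open>A\<close> plays the role of the functional and orthogonal
  vectors that of orthogonal idempotents. In dimension at least 3 any two vectors have a common
  nonzero orthogonal vector, which takes the place of frames and links.\<close>

lemma sym_matrix_eq_0:
  fixes A :: "real ^ 'n ^ 'n"
  assumes A: "A \<in> sym_matrices" and card: "CARD('n) \<ge> 3"
    and sign: "\<And>x y. x \<bullet> y = 0 \<Longrightarrow> (x \<bullet> (A *v x)) * (y \<bullet> (A *v y)) \<le> 0"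
  shows "A = 0"
proof -
  define q where "q x = x \<bullet> (A *v x)" for x
  have qadd: "q (x + s *\<^sub>R y) = q x + s * (2 * (x \<bullet> (A *v y))) + s\<^sup>2 * q y" for x y s
    using sym_matrix_inner_commute[OF A, of y x]
    by (simp add: q_def matrix_vector_right_distrib vec.scale inner_add matrix_vector_mult_scaleR
        power2_eq_square algebra_simps)
  have sign': "q x * q y \<le> 0" if "x \<bullet> y = 0" for x y
    using sign that by (simp add: q_def)
  have q0: "q u = 0" for u
  proof (rule ccontr)
    assume u: "q u \<noteq> 0"
    then have "u \<noteq> 0" by (auto simp: q_def)
    have ex: "\<exists>z. z \<noteq> 0 \<and> z \<bullet> x = 0 \<and> z \<bullet> y = 0" for x y :: "real ^ 'n"
    proof -
      have "dim {x, y} \<le> 2"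
        by (rule order.trans[OF dim_le_card']) (auto simp: card_insert_if)
      then have "dim {x, y} < DIM(real ^ 'n)" using card by simp
      then obtain z where "z \<noteq> 0" "\<And>y'. y' \<in> span {x, y} \<Longrightarrow> orthogonal z y'"
        using orthogonal_to_subspace_exists by blast
      then show ?thesis
        by (meson insertCI orthogonal_def span_base)
    qed
    obtain w where w: "w \<noteq> 0" "w \<bullet> u = 0" "q w = 0"
    proof -
      \<comment> \<open>On the pairwise orthogonal vectors \<open>u\<close>, \<open>v\<close>,
        \<open>z\<close> the values of \<open>q\<close> cannot all be nonzero.\<close>
      obtain v where v: "v \<noteq> 0" "v \<bullet> u = 0" using ex by blast
      obtain z where z: "z \<noteq> 0" "z \<bullet> u = 0" "z \<bullet> v = 0" using ex by blast
      have "q v * q u \<le> 0" "q z * q u \<le> 0" "q z * q v \<le> 0"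
        using v z sign' by auto
      then have "q v = 0 \<or> q z = 0"
        using u by (auto simp: mult_le_0_iff)
      then show thesis using v z that by blast
    qed
    \<comment> \<open>Equal lengths make \<open>u + s W\<close> and \<open>W - s u\<close>
      orthogonal for every \<open>s\<close>.\<close>
    define W where "W = (norm u / norm w) *\<^sub>R w"
    have W: "W \<bullet> u = 0" "W \<bullet> W = u \<bullet> u" "q W = 0"
      using w \<open>u \<noteq> 0\<close>
      by (auto simp: W_def q_def matrix_vector_mult_scaleR power2_eq_square
          simp flip: power2_norm_eq_inner)
    have "(q u + s * (2 * (u \<bullet> (A *v W)))) * (s\<^sup>2 * q u - s * (2 * (u \<bullet> (A *v W)))) \<le> 0" for s
    proof -
      have "(u + s *\<^sub>R W) \<bullet> (W + (- s) *\<^sub>R u) = 0"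
        using W by (simp add: inner_add inner_diff inner_commute algebra_simps)
      from sign'[OF this] show ?thesis
        using W sym_matrix_inner_commute[OF A, of W u]
        by (simp only: qadd) (simp add: algebra_simps)
    qed
    then show False using rotation_sign_change u by blast
  qed
  have "x \<bullet> (A *v y) = 0" for x y
    using qadd[of x 1 y] by (simp add: q0)
  then have "A *v y = 0" for y
    by (metis inner_eq_zero_iff)
  then show "A = 0"
    by (simp add: matrix_eq)
qed

section \<open>Peirce decompositions in Euclidean Jordan algebras\<close>

lemma scaleR_3_4:
  fixes x :: "'a::real_vector"
  shows "3 *\<^sub>R x = x + x + x" "4 *\<^sub>R x = x + x + x + x"
  using scaleR_left_distrib[of 2 1 x] scaleR_left_distrib[of 3 1 x] by (simp_all add: scaleR_2)

lemma nonpos_at_0: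
  fixes h :: "real \<Rightarrow> real"
  assumes "continuous_on UNIV h" "\<And>t. t > 0 \<Longrightarrow> h t \<le> 0"
  shows "h 0 \<le> 0"
proof (rule tendsto_upperbound)
  show "(h \<longlongrightarrow> h 0) (at_right 0)"
    using assms(1) by (meson UNIV_I continuous_on_def top_greatest tendsto_within_subset)
  show "eventually (\<lambda>t. h t \<le> 0) (at_right 0)"
    using assms(2) by (auto intro: eventually_at_right_less[THEN eventually_mono])
qed simp

text \<open>Dividing by \<open>t\<close> and letting \<open>t\<close> tend to 0 from both sides
  gives \<open>A = 0\<close>; dividing once more gives \<open>B \<le> 0\<close>. This supplies
  first- and second-order conditions at a maximum without derivatives.\<close>

lemma quartic_bound_coeffs:
  fixes A B C D :: real
  assumes le: "\<And>t. t * A + t\<^sup>2 * B + t^3 * C \<le> t^4 * D"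
  shows "A = 0" "B \<le> 0"
proof -
  have pos: "A + t * B + t\<^sup>2 * C - t^3 * D \<le> 0" if "t > 0" for t
  proof -
    have "t * (A + t * B + t\<^sup>2 * C - t^3 * D) \<le> 0"
      using le[of t] by (simp add: algebra_simps power2_eq_square power3_eq_cube power4_eq_xxxx)
    then show ?thesis using that by (simp add: mult_le_0_iff)
  qed
  have neg: "- A + t * B - t\<^sup>2 * C - t^3 * D \<le> 0" if "t > 0" for t
  proof -
    have "t * (- A + t * B - t\<^sup>2 * C - t^3 * D) \<le> 0"
      using le[of "- t"] by (simp add: algebra_simps power2_eq_square power3_eq_cube power4_eq_xxxx)
    then show ?thesis using that by (simp add: mult_le_0_iff)
  qed
  have "A + 0 * B + 0\<^sup>2 * C - 0^3 * D \<le> 0"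
    by (rule nonpos_at_0[OF _ pos]) (auto intro!: continuous_intros)
  moreover have "- A + 0 * B - 0\<^sup>2 * C - 0^3 * D \<le> 0"
    by (rule nonpos_at_0[OF _ neg]) (auto intro!: continuous_intros)
  ultimately show "A = 0" by simp
  have "B + t * C - t\<^sup>2 * D \<le> 0" if "t > 0" for t
  proof -
    have "t * (B + t * C - t\<^sup>2 * D) \<le> 0"
      using pos[OF that] \<open>A = 0\<close> by (simp add: algebra_simps power2_eq_square power3_eq_cube)
    then show ?thesis using that by (simp add: mult_le_0_iff)
  qed
  then have "B + 0 * C - 0\<^sup>2 * D \<le> 0"
    by (rule nonpos_at_0[rotated]) (auto intro!: continuous_intros)
  then show "B \<le> 0" by simp
qed

lemma scaleR_half_add:
  fixes y z :: "'a::real_vector"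
  shows "(k / 2) *\<^sub>R y + (k / 2) *\<^sub>R y = k *\<^sub>R y"
    and "(k / 2) *\<^sub>R y + ((k / 2) *\<^sub>R y + z) = k *\<^sub>R y + z"
  by (simp_all flip: scaleR_left_distrib add: add.assoc[symmetric])

lemmas scaleR_numerals = scaleR_2 scaleR_3_4

context euclidean_jordan_algebra
begin

notation jp (infixl "\<bullet>\<^sub>J" 77)

lemmas jp_linear =
  bilinear_ladd[OF bilinear] bilinear_radd[OF bilinear]
  bilinear_lsub[OF bilinear] bilinear_rsub[OF bilinear]
  bilinear_lmul[OF bilinear] bilinear_rmul[OF bilinear]
  bilinear_lneg[OF bilinear] bilinear_rneg[OF bilinear]
  bilinear_lzero[OF bilinear] bilinear_rzero[OF bilinear]

text \<open>Polarization of the Jordan identity: the part of degree one in \<open>z\<close> after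
  replacing \<open>x\<close> by \<open>x + z\<close>. Most Peirce rules below are instances.\<close>

lemma jordan_linearized:
  "z \<bullet>\<^sub>J (x \<bullet>\<^sub>J x \<bullet>\<^sub>J w) + 2 *\<^sub>R (x \<bullet>\<^sub>J (x \<bullet>\<^sub>J z \<bullet>\<^sub>J w)) = x \<bullet>\<^sub>J x \<bullet>\<^sub>J (z \<bullet>\<^sub>J w) + 2 *\<^sub>R (x \<bullet>\<^sub>J z \<bullet>\<^sub>J (x \<bullet>\<^sub>J w))"
proof -
  define T where "T = z \<bullet>\<^sub>J (x \<bullet>\<^sub>J x \<bullet>\<^sub>J w) + 2 *\<^sub>R (x \<bullet>\<^sub>J (x \<bullet>\<^sub>J z \<bullet>\<^sub>J w)) - x \<bullet>\<^sub>J x \<bullet>\<^sub>J (z \<bullet>\<^sub>J w) - 2 *\<^sub>R (x \<bullet>\<^sub>J z \<bullet>\<^sub>J (x \<bullet>\<^sub>J w))"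
  define D where "D y = y \<bullet>\<^sub>J (y \<bullet>\<^sub>J y \<bullet>\<^sub>J w) - y \<bullet>\<^sub>J y \<bullet>\<^sub>J (y \<bullet>\<^sub>J w)" for y
  have D: "D y = 0" for y by (simp add: D_def jordan)
  have "D (x + z) - D (x - z) - 2 *\<^sub>R D z = 2 *\<^sub>R T"
    by (simp add: D_def T_def jp_linear commute[of z x] algebra_simps scaleR_2)
  then have "T = 0" by (simp add: D)
  then show ?thesis by (simp add: T_def diff_diff_eq)
qed

subsection \<open>Idempotents\<close>

text \<open>The linearized identity says that multiplication by \<open>c\<close> is a root of
  \<open>k (k - 1) (2 k - 1)\<close>, so its only possible eigenvalues are \<open>0\<close>,
  \<open>1/2\<close> and \<open>1\<close>.\<close>

lemma peirce_polynomial: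
  assumes "c \<bullet>\<^sub>J c = c"
  shows "2 *\<^sub>R (c \<bullet>\<^sub>J (c \<bullet>\<^sub>J (c \<bullet>\<^sub>J z))) = 3 *\<^sub>R (c \<bullet>\<^sub>J (c \<bullet>\<^sub>J z)) - c \<bullet>\<^sub>J z"
proof -
  have "c \<bullet>\<^sub>J z + 2 *\<^sub>R (c \<bullet>\<^sub>J (c \<bullet>\<^sub>J (c \<bullet>\<^sub>J z))) = c \<bullet>\<^sub>J (c \<bullet>\<^sub>J z) + 2 *\<^sub>R (c \<bullet>\<^sub>J (c \<bullet>\<^sub>J z))"
    using jordan_linearized[of z c c] assms by (simp add: commute)
  also have "\<dots> = 3 *\<^sub>R (c \<bullet>\<^sub>J (c \<bullet>\<^sub>J z))"
    by (simp add: scaleR_numerals)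
  finally show ?thesis by (simp add: algebra_simps)
qed

lemma peirce_eigenvalue:
  assumes "c \<bullet>\<^sub>J c = c" "c \<bullet>\<^sub>J z = k *\<^sub>R z" "z \<noteq> 0"
  shows "k = 0 \<or> k = 1 \<or> k = 1/2"
proof -
  have "(2 * k^3 - 3 * k\<^sup>2 + k) *\<^sub>R z = 0"
    using peirce_polynomial[OF assms(1), of z] assms(2)
    by (simp add: jp_linear scaleR_diff_left scaleR_add_left power2_eq_square power3_eq_cube algebra_simps)
  then have "2 * k^3 - 3 * k\<^sup>2 + k = 0"
    using assms(3) by (simp only: scaleR_eq_0_iff) simp
  then have "k * (k - 1) * (2 * k - 1) = 0"
    by (simp add: algebra_simps power2_eq_square power3_eq_cube)
  then show ?thesis by auto
qed

text \<open>For idempotent \<open>c\<close> this projects onto the eigenspace of \<open>1\<close>: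
  it is the Lagrange polynomial \<open>2 k^2 - k\<close> of multiplication by \<open>c\<close>.
  Likewise \<open>peirceh\<close>, with \<open>4 (k - k^2)\<close>, projects onto the eigenspace of
  \<open>1/2\<close>.\<close>

definition peirce1 :: "'a \<Rightarrow> 'a \<Rightarrow> 'a" where
  "peirce1 c z = 2 *\<^sub>R (c \<bullet>\<^sub>J (c \<bullet>\<^sub>J z)) - c \<bullet>\<^sub>J z"

definition peirceh :: "'a \<Rightarrow> 'a \<Rightarrow> 'a" where
  "peirceh c z = 4 *\<^sub>R (c \<bullet>\<^sub>J z - c \<bullet>\<^sub>J (c \<bullet>\<^sub>J z))"

lemma peirce1: "c \<bullet>\<^sub>J c = c \<Longrightarrow> c \<bullet>\<^sub>J peirce1 c z = peirce1 c z"
  using peirce_polynomial[of c z]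
  by (simp add: peirce1_def jp_linear scaleR_numerals algebra_simps)

lemma peirceh: "c \<bullet>\<^sub>J c = c \<Longrightarrow> c \<bullet>\<^sub>J peirceh c z = (1/2) *\<^sub>R peirceh c z"
proof -
  assume "c \<bullet>\<^sub>J c = c"
  have "2 *\<^sub>R (c \<bullet>\<^sub>J peirceh c z) = 4 *\<^sub>R (2 *\<^sub>R (c \<bullet>\<^sub>J (c \<bullet>\<^sub>J z)) - 2 *\<^sub>R (c \<bullet>\<^sub>J (c \<bullet>\<^sub>J (c \<bullet>\<^sub>J z))))"
    by (simp add: peirceh_def jp_linear scaleR_diff_right)
  also have "\<dots> = peirceh c z"
    unfolding peirce_polynomial[OF \<open>c \<bullet>\<^sub>J c = c\<close>] peirceh_def
    by (simp add: scaleR_numerals algebra_simps)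
  finally have "2 *\<^sub>R (c \<bullet>\<^sub>J peirceh c z) = peirceh c z" .
  then show ?thesis by (metis scaleR_scaleR scaleR_one divide_self_if mult.commute times_divide_eq_right mult_1 zero_neq_numeral)
qed

lemma peirce_sum: "c \<bullet>\<^sub>J z = peirce1 c z + (1/2) *\<^sub>R peirceh c z"
  by (simp add: peirce1_def peirceh_def scaleR_diff_right) (simp add: scaleR_2)

lemma inner_peirce:
  shows "peirce1 c x \<bullet> y = x \<bullet> peirce1 c y" "peirceh c x \<bullet> y = x \<bullet> peirceh c y"
  by (simp_all add: peirce1_def peirceh_def inner_diff_left inner_diff_right inner_assoc)

text \<open>Both projections are self-adjoint and idempotent, so the spectral sum
  \<open>peirce_sum\<close> becomes a sum of squared norms. Hence multiplication by an idempotent is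
  positive semidefinite.\<close>

lemma inner_idempotent:
  assumes "c \<bullet>\<^sub>J c = c"
  shows "(c \<bullet>\<^sub>J z) \<bullet> z = (norm (peirce1 c z))\<^sup>2 + (1/2) * (norm (peirceh c z))\<^sup>2"
proof -
  have "peirce1 c (peirce1 c z) = peirce1 c z"
    using assms by (simp add: peirce1_def[of c "peirce1 c z"] peirce1 scaleR_2)
  then have a: "peirce1 c z \<bullet> peirce1 c z = peirce1 c z \<bullet> z"
    by (metis inner_commute inner_peirce(1))
  have "peirceh c (peirceh c z) = peirceh c z"
    using assms
    by (simp add: peirceh_def[of c "peirceh c z"] peirceh jp_linear flip: scaleR_left_diff_distrib)
  then have b: "peirceh c z \<bullet> peirceh c z = peirceh c z \<bullet> z"
    by (metis inner_commute inner_peirce(2))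
  show ?thesis
    by (subst peirce_sum) (simp add: inner_add_left a b power2_norm_eq_inner)
qed

lemma inner_idempotent_nonneg: "c \<bullet>\<^sub>J c = c \<Longrightarrow> 0 \<le> (c \<bullet>\<^sub>J z) \<bullet> z"
  by (simp add: inner_idempotent)

lemma inner_idempotent_eq_0: "c \<bullet>\<^sub>J c = c \<Longrightarrow> (c \<bullet>\<^sub>J z) \<bullet> z = 0 \<Longrightarrow> c \<bullet>\<^sub>J z = 0"
  using inner_idempotent[of c z] peirce_sum[of c z]
  by (simp add: add_nonneg_eq_0_iff)

lemma orthogonal_idempotents_commute:
  assumes "d \<bullet>\<^sub>J d = d" "c \<bullet>\<^sub>J d = 0"
  shows "c \<bullet>\<^sub>J (d \<bullet>\<^sub>J z) = d \<bullet>\<^sub>J (c \<bullet>\<^sub>J z)"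
  using jordan_linearized[of c d z] assms by (simp add: commute[of d c] jp_linear)

lemma orthogonal_idempotents_add:
  assumes "c \<bullet>\<^sub>J c = c" "d \<bullet>\<^sub>J d = d" "c \<bullet>\<^sub>J d = 0"
  shows "(c + d) \<bullet>\<^sub>J (c + d) = c + d"
  using assms by (simp add: jp_linear commute[of d c])

lemma idempotent_add_orthogonal:
  assumes "a \<bullet>\<^sub>J a = a" "b \<bullet>\<^sub>J b = b" "(a + b) \<bullet>\<^sub>J (a + b) = a + b"
  shows "a \<bullet>\<^sub>J b = 0"
proof -
  have "2 *\<^sub>R (a \<bullet>\<^sub>J b) = 0"
    using assms by (simp add: jp_linear commute[of b a] scaleR_2 add.assoc)
  then show ?thesis by simp
qed

lemma inner_idempotents:
  assumes "a \<bullet>\<^sub>J a = a"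
  shows "(d \<bullet>\<^sub>J a) \<bullet> a = d \<bullet> a"
  using assms inner_assoc[of a d a] by (simp add: commute[of d a])

text \<open>\<open>d \<bullet> a\<close> and \<open>d \<bullet> b\<close> are nonnegative with sum
  zero, so both vanish, and a null vector of a positive semidefinite form lies in the kernel. This
  preserves orthogonality when an idempotent is split.\<close>

lemma orthogonal_summand:
  assumes d: "d \<bullet>\<^sub>J d = d" and a: "a \<bullet>\<^sub>J a = a" and b: "b \<bullet>\<^sub>J b = b"
    and "d \<bullet>\<^sub>J (a + b) = 0"
  shows "d \<bullet>\<^sub>J a = 0"
proof -
  have "d \<bullet> (a + b) = 0"
    using inner_assoc[of d d "a + b"] d assms(4) by simp
  moreover have "0 \<le> d \<bullet> a" "0 \<le> d \<bullet> b"
    using inner_idempotent_nonneg[OF d] inner_idempotents[OF a] inner_idempotents[OF b] by metis+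
  ultimately have "d \<bullet> a = 0" by (simp add: inner_add_right)
  then show ?thesis
    using inner_idempotent_eq_0[OF d, of a] inner_idempotents[OF a] by simp
qed

text \<open>On the component of \<open>w\<close> in the eigenspace of \<open>d\<close> for
  \<open>1\<close>, the idempotent \<open>c + d\<close> would have the impossible eigenvalue
  \<open>3/2\<close>. So multiplication by \<open>d\<close> moves \<open>w\<close> into the joint
  Peirce space of \<open>c\<close> and \<open>d\<close>.\<close>

lemma peirce_half_component:
  assumes c: "c \<bullet>\<^sub>J c = c" and d: "d \<bullet>\<^sub>J d = d" and cd: "c \<bullet>\<^sub>J d = 0"
    and w: "c \<bullet>\<^sub>J w = (1/2) *\<^sub>R w"
  shows "c \<bullet>\<^sub>J (d \<bullet>\<^sub>J w) = (1/2) *\<^sub>R (d \<bullet>\<^sub>J w)" "d \<bullet>\<^sub>J (d \<bullet>\<^sub>J w) = (1/2) *\<^sub>R (d \<bullet>\<^sub>J w)"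
proof -
  show c1: "c \<bullet>\<^sub>J (d \<bullet>\<^sub>J w) = (1/2) *\<^sub>R (d \<bullet>\<^sub>J w)"
    using orthogonal_idempotents_commute[OF d cd, of w] w by (simp add: jp_linear)
  have "c \<bullet>\<^sub>J (d \<bullet>\<^sub>J (d \<bullet>\<^sub>J w)) = (1/2) *\<^sub>R (d \<bullet>\<^sub>J (d \<bullet>\<^sub>J w))"
    using orthogonal_idempotents_commute[OF d cd, of "d \<bullet>\<^sub>J w"] c1 by (simp add: jp_linear)
  with c1 have "c \<bullet>\<^sub>J peirce1 d w = (1/2) *\<^sub>R peirce1 d w"
    by (simp add: peirce1_def jp_linear scaleR_diff_right)
  then have "(c + d) \<bullet>\<^sub>J peirce1 d w = (1/2) *\<^sub>R peirce1 d w + 1 *\<^sub>R peirce1 d w"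
    by (simp add: jp_linear peirce1[OF d])
  then have "(c + d) \<bullet>\<^sub>J peirce1 d w = (3/2) *\<^sub>R peirce1 d w"
    unfolding scaleR_left_distrib[symmetric] by simp
  from peirce_eigenvalue[OF orthogonal_idempotents_add[OF c d cd] this]
  have "peirce1 d w = 0" by auto
  then have "2 *\<^sub>R (d \<bullet>\<^sub>J (d \<bullet>\<^sub>J w)) = d \<bullet>\<^sub>J w" by (simp add: peirce1_def)
  then show "d \<bullet>\<^sub>J (d \<bullet>\<^sub>J w) = (1/2) *\<^sub>R (d \<bullet>\<^sub>J w)"
    by (metis scaleR_scaleR scaleR_one divide_self_if mult.commute times_divide_eq_right mult_1 zero_neq_numeral)
qed

text \<open>This places the product of \<open>c\<close> and the square of \<open>x\<close> in the
  eigenspace of \<open>c\<close> for \<open>1\<close>, which is a line when \<open>c\<close> is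
  primitive.\<close>

lemma peirce_half_square:
  assumes "c \<bullet>\<^sub>J c = c" and x: "c \<bullet>\<^sub>J x = (1/2) *\<^sub>R x"
  shows "c \<bullet>\<^sub>J (c \<bullet>\<^sub>J (x \<bullet>\<^sub>J x)) = c \<bullet>\<^sub>J (x \<bullet>\<^sub>J x)"
  using jordan_linearized[of c x c] assms
  by (simp add: jp_linear commute[of x c] commute[of "x \<bullet>\<^sub>J x" c])

lemma peirce_one_closed:
  assumes "c \<bullet>\<^sub>J c = c" "c \<bullet>\<^sub>J x = x" "c \<bullet>\<^sub>J y = y"
  shows "c \<bullet>\<^sub>J (x \<bullet>\<^sub>J y) = x \<bullet>\<^sub>J y"
proof -
  have "x \<bullet>\<^sub>J y + 2 *\<^sub>R (c \<bullet>\<^sub>J (x \<bullet>\<^sub>J y)) = c \<bullet>\<^sub>J (x \<bullet>\<^sub>J y) + 2 *\<^sub>R (x \<bullet>\<^sub>J y)"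
    using jordan_linearized[of x c y] assms by simp
  then show ?thesis by (simp add: scaleR_2)
qed

text \<open>One instance of the linearized identity puts the product in the eigenspace of
  \<open>1\<close>; the other then equates it with its double.\<close>

lemma peirce_one_zero:
  assumes "c \<bullet>\<^sub>J c = c" "c \<bullet>\<^sub>J x = x" "c \<bullet>\<^sub>J y = 0"
  shows "x \<bullet>\<^sub>J y = 0"
proof -
  have "x \<bullet>\<^sub>J y = c \<bullet>\<^sub>J (x \<bullet>\<^sub>J y)"
    using jordan_linearized[of y c x] assms by (simp add: jp_linear commute[of y x])
  moreover have "2 *\<^sub>R (c \<bullet>\<^sub>J (x \<bullet>\<^sub>J y)) = c \<bullet>\<^sub>J (x \<bullet>\<^sub>J y)"
    using jordan_linearized[of x c y] assms by (simp add: jp_linear)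
  ultimately show ?thesis by (simp add: scaleR_2)
qed

subsection \<open>Primitive idempotents\<close>

text \<open>
  Take a maximizer \<open>x\<close> of \<open>\<langle>z, z\<^sup>2\<rangle>\<close> on the unit sphere of \<open>W\<close>. The first-order condition makes it a
  multiple of an idempotent \<open>b\<close>; the second-order condition bounds the eigenvalues of
  multiplication by \<open>b\<close> on the complement of \<open>b\<close> by \<open>1/2\<close>.
  This replaces the spectral theorem.
\<close>

lemma exists_idempotent_simple_eigenvalue:
  fixes W :: "'a set"
  assumes W: "subspace W" "\<And>x y. x \<in> W \<Longrightarrow> y \<in> W \<Longrightarrow> x \<bullet>\<^sub>J y \<in> W"
    and c: "c \<in> W" "c \<bullet>\<^sub>J c = c" "c \<noteq> 0"
  obtains b where "b \<in> W" "b \<noteq> 0" "b \<bullet>\<^sub>J b = b"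
    and "\<And>z. z \<in> W \<Longrightarrow> b \<bullet>\<^sub>J z = z \<Longrightarrow> \<exists>k. z = k *\<^sub>R b"
proof -
  define g where "g z = z \<bullet> (z \<bullet>\<^sub>J z)" for z
  have "continuous_on (W \<inter> sphere 0 1) g"
    unfolding g_def
    by (intro continuous_intros bounded_bilinear.continuous_on[OF bilinear_conv_bounded_bilinear[THEN iffD1, OF bilinear]])
  moreover have "compact (W \<inter> sphere 0 1)"
    using closed_subspace[OF W(1)] by (simp add: closed_Int_compact)
  moreover have c1: "(1 / norm c) *\<^sub>R c \<in> W \<inter> sphere 0 1"
    using c W(1) by (simp add: subspace_scale)
  then have "W \<inter> sphere 0 1 \<noteq> {}" by blast
  ultimately have "\<exists>x\<in>W \<inter> sphere 0 1. \<forall>y\<in>W \<inter> sphere 0 1. g y \<le> g x"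
    by (intro continuous_attains_sup)
  then obtain x where x: "x \<in> W" "norm x = 1"
    and max: "\<And>z. z \<in> W \<Longrightarrow> norm z = 1 \<Longrightarrow> g z \<le> g x"
    by auto
  define \<mu> where "\<mu> = g x"
  have gscale: "g (k *\<^sub>R z) = k^3 * g z" for k z
    by (simp add: g_def jp_linear power3_eq_cube)
  \<comment> \<open>\<open>g c = c \<bullet> c\<close> because \<open>c\<close> is idempotent, so
    the maximum is positive.\<close>
  have "0 < g ((1 / norm c) *\<^sub>R c)"
    using c by (simp add: gscale) (simp add: g_def)
  then have \<mu>: "\<mu> > 0"
    using max[of "(1 / norm c) *\<^sub>R c"] c1 by (simp add: \<mu>_def)
  have bound: "g z \<le> \<mu> * norm z ^ 3" if "z \<in> W" for z
  proof (cases "z = 0")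
    case False
    then have "g ((1 / norm z) *\<^sub>R z) \<le> \<mu>"
      unfolding \<mu>_def using that W(1) by (intro max) (auto simp: subspace_scale)
    then show ?thesis using False by (simp add: gscale field_simps)
  qed (simp add: g_def)
  have critical: "(x \<bullet>\<^sub>J x) \<bullet> y = 0 \<and> (x \<bullet>\<^sub>J y) \<bullet> y \<le> \<mu> / 2 * (norm y)\<^sup>2"
    if y: "y \<in> W" "x \<bullet> y = 0" for y
  proof -
    define n where "n = (norm y)\<^sup>2"
    have "t * (3 * ((x \<bullet>\<^sub>J x) \<bullet> y)) + t\<^sup>2 * (3 * ((x \<bullet>\<^sub>J y) \<bullet> y) - 3/2 * \<mu> * n) + t^3 * g y
        \<le> t^4 * (3/8 * \<mu> * n\<^sup>2)" for t
    proof -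
      have sym: "x \<bullet> (x \<bullet>\<^sub>J y) = (x \<bullet>\<^sub>J x) \<bullet> y" "y \<bullet> (x \<bullet>\<^sub>J x) = (x \<bullet>\<^sub>J x) \<bullet> y"
        "x \<bullet> (y \<bullet>\<^sub>J y) = (x \<bullet>\<^sub>J y) \<bullet> y" "y \<bullet> (x \<bullet>\<^sub>J y) = (x \<bullet>\<^sub>J y) \<bullet> y"
        using inner_assoc[of x x y] inner_assoc[of y x y] by (simp_all add: inner_commute commute[of y x])
      have "g (x + t *\<^sub>R y) = \<mu> + t * (3 * ((x \<bullet>\<^sub>J x) \<bullet> y)) + t\<^sup>2 * (3 * ((x \<bullet>\<^sub>J y) \<bullet> y)) + t^3 * g y"
        by (simp add: g_def \<mu>_def jp_linear commute[of y x] inner_add_left inner_add_right sym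
            power2_eq_square power3_eq_cube algebra_simps)
      \<comment> \<open>With \<open>s = t^2 * n\<close>, this bounds \<open>(1 + s)^(3/2)\<close> by
        its Taylor polynomial of degree two; comparing squares avoids roots.\<close>
      moreover have "norm (x + t *\<^sub>R y) ^ 3 \<le> 1 + 3/2 * (t\<^sup>2 * n) + 3/8 * (t\<^sup>2 * n)\<^sup>2"
      proof (rule power2_le_imp_le)
        have "(norm (x + t *\<^sub>R y))\<^sup>2 = 1 + t\<^sup>2 * n"
          using x y unfolding n_def power2_norm_eq_inner
          by (simp add: norm_eq_1 inner_add_left inner_add_right inner_commute[of y x] power2_eq_square)
        then have "(norm (x + t *\<^sub>R y) ^ 3)\<^sup>2 = (1 + t\<^sup>2 * n) ^ 3"
          by (metis power_mult mult.commute)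
        also have "\<dots> \<le> (1 + 3/2 * (t\<^sup>2 * n) + 3/8 * (t\<^sup>2 * n)\<^sup>2)\<^sup>2"
        proof -
          have "(1 + 3/2 * s + 3/8 * s\<^sup>2)\<^sup>2 - (1 + s) ^ 3 = s^3 / 8 + 9/64 * s^4" for s :: real
            by (simp add: power2_eq_square power3_eq_cube power4_eq_xxxx field_simps)
          moreover have "0 \<le> (t\<^sup>2 * n)^3 / 8 + 9/64 * (t\<^sup>2 * n)^4" by (simp add: n_def)
          ultimately show ?thesis by (metis diff_ge_0_iff_ge)
        qed
        finally show "(norm (x + t *\<^sub>R y) ^ 3)\<^sup>2 \<le> (1 + 3/2 * (t\<^sup>2 * n) + 3/8 * (t\<^sup>2 * n)\<^sup>2)\<^sup>2" .
      qed (simp add: n_def)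
      then have "\<mu> * norm (x + t *\<^sub>R y) ^ 3 \<le> \<mu> * (1 + 3/2 * (t\<^sup>2 * n) + 3/8 * (t\<^sup>2 * n)\<^sup>2)"
        using \<mu> by (intro mult_left_mono) auto
      moreover have "g (x + t *\<^sub>R y) \<le> \<mu> * norm (x + t *\<^sub>R y) ^ 3"
        using x y W(1) by (intro bound) (simp add: subspace_add subspace_scale)
      ultimately show ?thesis
        by (simp add: algebra_simps power2_eq_square power4_eq_xxxx)
    qed
    from quartic_bound_coeffs[OF this] show ?thesis by (simp add: n_def)
  qed
  have xx: "x \<bullet>\<^sub>J x = \<mu> *\<^sub>R x"
  proof -
    \<comment> \<open>\<open>y\<close> is the component of the square of \<open>x\<close> orthogonal
      to \<open>x\<close>. The first-order condition makes it orthogonal to that square too, hence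
      to itself.\<close>
    define y where "y = x \<bullet>\<^sub>J x - \<mu> *\<^sub>R x"
    have "y \<in> W" using x W by (simp add: y_def subspace_diff subspace_scale)
    moreover have xy: "x \<bullet> y = 0"
      using x by (simp add: y_def inner_diff_right g_def \<mu>_def norm_eq_1)
    ultimately have "(x \<bullet>\<^sub>J x) \<bullet> y = 0" using critical by blast
    then have "y \<bullet> y = 0" using xy unfolding y_def by (simp add: inner_diff_left)
    then show ?thesis by (simp add: y_def)
  qed
  show thesis
  proof (rule that[of "(1/\<mu>) *\<^sub>R x"])
    show "(1/\<mu>) *\<^sub>R x \<in> W" using x W by (simp add: subspace_scale)
    show "(1/\<mu>) *\<^sub>R x \<noteq> 0" using x \<mu> by auto
    show "((1/\<mu>) *\<^sub>R x) \<bullet>\<^sub>J ((1/\<mu>) *\<^sub>R x) = (1/\<mu>) *\<^sub>R x"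
      using \<mu> by (simp add: jp_linear xx)
    fix z assume z: "z \<in> W" "((1/\<mu>) *\<^sub>R x) \<bullet>\<^sub>J z = z"
    then have xz: "x \<bullet>\<^sub>J z = \<mu> *\<^sub>R z"
      using \<mu> by (metis jp_linear(5) scaleR_scaleR scaleR_one nonzero_mult_div_cancel_left
          times_divide_eq_right mult.right_neutral less_irrefl)
    \<comment> \<open>Were this component nonzero, it would be an eigenvector for
      \<open>\<mu>\<close>, above the second-order bound \<open>\<mu> / 2\<close>.\<close>
    define y where "y = z - (x \<bullet> z) *\<^sub>R x"
    have "y \<in> W" using x z W by (simp add: y_def subspace_diff subspace_scale)
    moreover have "x \<bullet> y = 0" using x by (simp add: y_def inner_diff_right norm_eq_1)
    ultimately have "(x \<bullet>\<^sub>J y) \<bullet> y \<le> \<mu> / 2 * (norm y)\<^sup>2" using critical by blast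
    moreover have "x \<bullet>\<^sub>J y = \<mu> *\<^sub>R y"
      by (simp add: y_def jp_linear xz xx scaleR_diff_right)
    ultimately have "y \<bullet> y \<le> 0" using \<mu> by (simp add: power2_norm_eq_inner)
    then have "y = 0" by (metis inner_gt_zero_iff not_less)
    then show "\<exists>k. z = k *\<^sub>R (1/\<mu>) *\<^sub>R x"
      using \<mu> by (intro exI[of _ "\<mu> * (x \<bullet> z)"]) (simp add: y_def)
  qed
qed

text \<open>The eigenspace of \<open>1\<close> is a subalgebra, so it contains an idempotent
  \<open>b\<close> whose own eigenspace of \<open>1\<close> in it is a line. As \<open>c - b\<close>
  is idempotent as well, primitivity forces \<open>b = c\<close>.\<close>

lemma primitive_idempotent_peirce_one:
  assumes "primitive_idempotent jp c" "c \<bullet>\<^sub>J z = z"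
  obtains k where "z = k *\<^sub>R c"
proof -
  have c: "c \<bullet>\<^sub>J c = c" "c \<noteq> 0"
    and prim: "\<And>a b. a \<bullet>\<^sub>J a = a \<Longrightarrow> a \<noteq> 0 \<Longrightarrow> b \<bullet>\<^sub>J b = b \<Longrightarrow> b \<noteq> 0 \<Longrightarrow> c \<noteq> a + b"
    using assms(1) by (auto simp: primitive_idempotent_def idempotent_def)
  have "subspace {z. c \<bullet>\<^sub>J z = z}" by (auto simp: subspace_def jp_linear)
  moreover have "x \<bullet>\<^sub>J y \<in> {z. c \<bullet>\<^sub>J z = z}"
    if "x \<in> {z. c \<bullet>\<^sub>J z = z}" "y \<in> {z. c \<bullet>\<^sub>J z = z}" for x y
    using that peirce_one_closed[OF c(1)] by simp
  ultimately obtain b where b: "c \<bullet>\<^sub>J b = b" "b \<noteq> 0" "b \<bullet>\<^sub>J b = b"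
    and k: "\<And>z. c \<bullet>\<^sub>J z = z \<Longrightarrow> b \<bullet>\<^sub>J z = z \<Longrightarrow> \<exists>k. z = k *\<^sub>R b"
    using c by (elim exists_idempotent_simple_eigenvalue[of _ c]) auto
  have "(c - b) \<bullet>\<^sub>J (c - b) = c - b"
    using b c by (simp add: jp_linear commute[of b c])
  then have "b = c" using prim[of b "c - b"] b by auto
  then show thesis using k assms(2) that by blast
qed

subsection \<open>Peirce spaces of a Jordan frame\<close>

text \<open>\<open>c + d\<close> fixes \<open>x\<close> and hence its square, which is therefore a
  combination of \<open>c\<close> and \<open>d\<close>. The norm equations also show that
  \<open>c\<close> and \<open>d\<close> have equal norm once \<open>x \<noteq> 0\<close>.\<close>

lemma off_diagonal_square:
  assumes c: "primitive_idempotent jp c" and d: "primitive_idempotent jp d" and cd: "c \<bullet>\<^sub>J d = 0"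
    and x: "c \<bullet>\<^sub>J x = (1/2) *\<^sub>R x" "d \<bullet>\<^sub>J x = (1/2) *\<^sub>R x"
  obtains l where "x \<bullet>\<^sub>J x = l *\<^sub>R (c + d)" "l * (c \<bullet> c) = (x \<bullet> x) / 2" "l * (d \<bullet> d) = (x \<bullet> x) / 2"
proof -
  have cc: "c \<bullet>\<^sub>J c = c" and dd: "d \<bullet>\<^sub>J d = d"
    using c d by (auto simp: primitive_idempotent_def idempotent_def)
  obtain l where l: "c \<bullet>\<^sub>J (x \<bullet>\<^sub>J x) = l *\<^sub>R c"
    using primitive_idempotent_peirce_one[OF c] peirce_half_square[OF cc x(1)] by metis
  obtain m where m: "d \<bullet>\<^sub>J (x \<bullet>\<^sub>J x) = m *\<^sub>R d"
    using primitive_idempotent_peirce_one[OF d] peirce_half_square[OF dd x(2)] by metis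
  have "(c + d) \<bullet>\<^sub>J x = x"
    using x by (simp add: jp_linear flip: scaleR_left_distrib)
  from peirce_one_closed[OF orthogonal_idempotents_add[OF cc dd cd] this this]
  have xx: "x \<bullet>\<^sub>J x = l *\<^sub>R c + m *\<^sub>R d"
    by (simp add: jp_linear l m)
  have norms: "l * (c \<bullet> c) = (x \<bullet> x) / 2" "m * (d \<bullet> d) = (x \<bullet> x) / 2"
  proof -
    have "(c \<bullet>\<^sub>J (x \<bullet>\<^sub>J x)) \<bullet> c = (x \<bullet>\<^sub>J x) \<bullet> c" "(d \<bullet>\<^sub>J (x \<bullet>\<^sub>J x)) \<bullet> d = (x \<bullet>\<^sub>J x) \<bullet> d"
      using inner_assoc[of c "x \<bullet>\<^sub>J x" c] inner_assoc[of d "x \<bullet>\<^sub>J x" d] cc dd by simp_all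
    moreover have "(x \<bullet>\<^sub>J x) \<bullet> c = (x \<bullet> x) / 2" "(x \<bullet>\<^sub>J x) \<bullet> d = (x \<bullet> x) / 2"
      using x by (simp_all add: inner_assoc[of x x] commute[of x c] commute[of x d])
    ultimately show "l * (c \<bullet> c) = (x \<bullet> x) / 2" "m * (d \<bullet> d) = (x \<bullet> x) / 2"
      by (simp_all add: l m)
  qed
  show thesis
  proof (cases "x = 0")
    case True
    then show ?thesis using that[of 0] by (simp add: jp_linear)
  next
    case False
    \<comment> \<open>Evaluating the Jordan identity at \<open>x\<close> and \<open>c\<close> in two
      ways gives \<open>l = m\<close>.\<close>
    have "(x \<bullet>\<^sub>J x) \<bullet>\<^sub>J (x \<bullet>\<^sub>J c) = (l / 4) *\<^sub>R x + (m / 4) *\<^sub>R x"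
      unfolding xx by (simp add: commute[of x c] jp_linear x scaleR_add_right)
    moreover have "x \<bullet>\<^sub>J ((x \<bullet>\<^sub>J x) \<bullet>\<^sub>J c) = (l / 2) *\<^sub>R x"
      by (simp only: commute[of "x \<bullet>\<^sub>J x" c] l) (simp add: jp_linear commute[of x c] x)
    ultimately have "(l / 4) *\<^sub>R x + (m / 4) *\<^sub>R x = (l / 2) *\<^sub>R x"
      using jordan[of x c] by simp
    then have "(l / 4 + m / 4) *\<^sub>R x = (l / 2) *\<^sub>R x" by (simp only: scaleR_left_distrib)
    then have "l = m" using False by (simp only: scaleR_cancel_right) simp
    then show ?thesis using that[of l] xx norms by (simp add: scaleR_add_right)
  qed
qed

section \<open>Off-diagonal links and rotations of idempotents\<close>

definition linked :: "'a \<Rightarrow> 'a \<Rightarrow> bool" where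
  "linked c d \<longleftrightarrow> (\<exists>x. x \<noteq> 0 \<and> c \<bullet>\<^sub>J x = (1/2) *\<^sub>R x \<and> d \<bullet>\<^sub>J x = (1/2) *\<^sub>R x)"

text \<open>The factor \<open>l\<close> in the square of \<open>x\<close> is positive, so
  \<open>x\<close> can be divided by \<open>sqrt l\<close>. The result behaves like the matrix with
  rows \<open>(0, 1)\<close> and \<open>(1, 0)\<close> beside diagonal units \<open>c\<close> and
  \<open>d\<close>.\<close>

lemma linked_normalized:
  assumes c: "primitive_idempotent jp c" and d: "primitive_idempotent jp d" and cd: "c \<bullet>\<^sub>J d = 0"
    and x: "x \<noteq> 0" "c \<bullet>\<^sub>J x = (1/2) *\<^sub>R x" "d \<bullet>\<^sub>J x = (1/2) *\<^sub>R x"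
  obtains k where "k \<noteq> 0" "(k *\<^sub>R x) \<bullet>\<^sub>J (k *\<^sub>R x) = c + d"
proof -
  obtain l where l: "x \<bullet>\<^sub>J x = l *\<^sub>R (c + d)" "l * (c \<bullet> c) = (x \<bullet> x) / 2"
    using off_diagonal_square[OF c d cd x(2,3)] by metis
  have "l > 0"
    using l(2) x(1) by (metis half_gt_zero inner_ge_zero inner_gt_zero_iff zero_less_mult_pos2 inner_zero_left
        mult_zero_right not_less_iff_gr_or_eq order_le_less)
  then show thesis
    using that[of "1 / sqrt l"] by (simp add: jp_linear l(1))
qed

text \<open>In the model of 2 by 2 symmetric matrices these are the rank-one matrices of the
  orthogonal vectors \<open>(1, s)\<close> and \<open>(- s, 1)\<close>.\<close>

lemma rotated_idempotents:
  assumes cd: "c \<bullet>\<^sub>J c = c" "d \<bullet>\<^sub>J d = d" "c \<bullet>\<^sub>J d = 0"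
    and x: "c \<bullet>\<^sub>J x = (1/2) *\<^sub>R x" "d \<bullet>\<^sub>J x = (1/2) *\<^sub>R x" "x \<bullet>\<^sub>J x = c + d"
  shows "(c + s *\<^sub>R x + s\<^sup>2 *\<^sub>R d) \<bullet>\<^sub>J (c + s *\<^sub>R x + s\<^sup>2 *\<^sub>R d) = (1 + s\<^sup>2) *\<^sub>R (c + s *\<^sub>R x + s\<^sup>2 *\<^sub>R d)" (is ?P)
    and "(s\<^sup>2 *\<^sub>R c - s *\<^sub>R x + d) \<bullet>\<^sub>J (s\<^sup>2 *\<^sub>R c - s *\<^sub>R x + d) = (1 + s\<^sup>2) *\<^sub>R (s\<^sup>2 *\<^sub>R c - s *\<^sub>R x + d)" (is ?Q)
    and "(c + s *\<^sub>R x + s\<^sup>2 *\<^sub>R d) \<bullet>\<^sub>J (s\<^sup>2 *\<^sub>R c - s *\<^sub>R x + d) = 0" (is ?R)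
proof -
  note swap = commute[of x c] commute[of x d] commute[of d c]
  show ?P ?Q ?R
    by (simp_all add: jp_linear cd x swap algebra_simps power2_eq_square scaleR_half_add)
qed

text \<open>Otherwise every vector splits into parts in the eigenspaces of \<open>1\<close> and
  \<open>0\<close>. The latter annihilates the former, which is then an ideal containing
  \<open>c\<close> but not \<open>e\<close>.\<close>

lemma simple_peirce_half:
  assumes simple: "jordan_simple jp" and c: "c \<bullet>\<^sub>J c = c" "c \<noteq> 0" "c \<noteq> e"
  obtains w where "w \<noteq> 0" "c \<bullet>\<^sub>J w = (1/2) *\<^sub>R w"
proof (cases "\<forall>z. peirceh c z = 0")
  case False
  then show thesis using that peirceh[OF c(1)] by blast
next
  case True
  define I where "I = {z. c \<bullet>\<^sub>J z = z}"
  have "x \<bullet>\<^sub>J y \<in> I" if "y \<in> I" for x y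
  proof -
    have y: "c \<bullet>\<^sub>J y = y" using that by (simp add: I_def)
    have "c \<bullet>\<^sub>J x = peirce1 c x" using peirce_sum[of c x] True by simp
    then have cx: "c \<bullet>\<^sub>J (c \<bullet>\<^sub>J x) = c \<bullet>\<^sub>J x" using peirce1[OF c(1)] by metis
    then have "y \<bullet>\<^sub>J (x - c \<bullet>\<^sub>J x) = 0"
      by (intro peirce_one_zero[OF c(1) y]) (simp add: jp_linear)
    then have "x \<bullet>\<^sub>J y = y \<bullet>\<^sub>J (c \<bullet>\<^sub>J x)" by (simp add: jp_linear commute[of x y])
    then show ?thesis using peirce_one_closed[OF c(1) y cx] by (simp add: I_def)
  qed
  then have "jordan_ideal jp I"
    by (auto simp: jordan_ideal_def subspace_def I_def jp_linear)
  then have "I = {0} \<or> I = UNIV" using simple by (auto simp: jordan_simple_def)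
  moreover have "c \<in> I" using c by (simp add: I_def)
  moreover have "e \<notin> I" using c unit[of c] by (simp add: I_def commute[of c e])
  ultimately show thesis using c by auto
qed

section \<open>Existence and components of Jordan frames\<close>

lemma jordan_frameD:
  assumes "jordan_frame jp e C"
  shows "finite C" "\<And>c. c \<in> C \<Longrightarrow> primitive_idempotent jp c" "\<And>c. c \<in> C \<Longrightarrow> c \<bullet>\<^sub>J c = c"
    "\<And>c. c \<in> C \<Longrightarrow> c \<noteq> 0" "\<And>c d. c \<in> C \<Longrightarrow> d \<in> C \<Longrightarrow> c \<noteq> d \<Longrightarrow> c \<bullet>\<^sub>J d = 0" "\<Sum>C = e"
  using assms by (auto simp: jordan_frame_def primitive_idempotent_def idempotent_def)

lemma jordan_frame_sum:
  assumes "jordan_frame jp e C"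
  shows "v = (\<Sum>c\<in>C. c \<bullet>\<^sub>J v)"
proof -
  have "linear (\<lambda>c. c \<bullet>\<^sub>J v)" using bilinear by (simp add: bilinear_def)
  from linear_sum[OF this, of "\<lambda>c. c" C] show ?thesis
    using jordan_frameD(6)[OF assms] unit[of v] by simp
qed

lemma frame_half_component:
  assumes C: "jordan_frame jp e C" and D: "D \<subseteq> C"
    and w: "w \<noteq> 0" "(\<Sum>D) \<bullet>\<^sub>J w = (1/2) *\<^sub>R w"
  shows "\<exists>d\<in>C - D. d \<bullet>\<^sub>J w \<noteq> 0"
proof (rule ccontr)
  assume "\<not> ?thesis"
  then have zero: "d \<bullet>\<^sub>J w = 0" if "d \<in> C - D" for d using that by auto
  have "linear (\<lambda>c. c \<bullet>\<^sub>J w)" using bilinear by (simp add: bilinear_def)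
  from linear_sum[OF this, of "\<lambda>c. c" D] have "(\<Sum>d\<in>D. d \<bullet>\<^sub>J w) = (1/2) *\<^sub>R w" using w by simp
  moreover have "w = (\<Sum>d\<in>D. d \<bullet>\<^sub>J w)"
    using jordan_frame_sum[OF C, of w] zero D jordan_frameD(1)[OF C]
    by (metis (no_types, lifting) sum.mono_neutral_right)
  ultimately have "(1/2) *\<^sub>R w = 1 *\<^sub>R w" by simp
  then show False using w(1) by (simp only: scaleR_cancel_right) simp
qed

text \<open>Orthogonality bounds the size of a system of nonzero orthogonal idempotents with sum
  \<open>e\<close> by the dimension. In a largest one every member is primitive, since splitting a
  member would enlarge it. So the choice in \<open>jordan_rank\<close> is a genuine frame.\<close>

lemma exists_jordan_frame: "\<exists>C. jordan_frame jp e C"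
proof -
  define P where "P C \<longleftrightarrow> finite C \<and> (\<forall>c\<in>C. c \<bullet>\<^sub>J c = c \<and> c \<noteq> 0) \<and>
     (\<forall>c\<in>C. \<forall>d\<in>C. c \<noteq> d \<longrightarrow> c \<bullet>\<^sub>J d = 0) \<and> \<Sum>C = e" for C
  have "e \<noteq> 0"
  proof
    assume "e = 0"
    then have "x = 0" for x :: 'a using unit[of x] by (simp add: jp_linear)
    then show False using nonempty_Basis nonzero_Basis by blast
  qed
  then have "P {e}" by (simp add: P_def unit)
  moreover have "card C < Suc (DIM('a))" if "P C" for C
  proof -
    have "c \<bullet> d = 0" if "c \<in> C" "d \<in> C" "c \<noteq> d" for c d
      using \<open>P C\<close> that inner_assoc[of c c d] unfolding P_def by simp
    then have "pairwise orthogonal C" by (simp add: pairwise_def orthogonal_def)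
    moreover have "0 \<notin> C" using that by (auto simp: P_def)
    ultimately show ?thesis
      using pairwise_orthogonal_independent independent_bound by (metis less_Suc_eq_le)
  qed
  ultimately obtain C where C: "P C" and max: "\<And>D. P D \<Longrightarrow> card D \<le> card C"
    using ex_has_greatest_nat[of P "{e}" card "Suc (DIM('a))"] by blast
  have "primitive_idempotent jp c" if c: "c \<in> C" for c
    unfolding primitive_idempotent_def idempotent_def
  proof (intro conjI notI)
    show "c \<bullet>\<^sub>J c = c" using C c by (simp add: P_def)
    show "c = 0 \<Longrightarrow> False" using C c unfolding P_def by blast
    assume "\<exists>a b. a \<bullet>\<^sub>J a = a \<and> a \<noteq> 0 \<and> b \<bullet>\<^sub>J b = b \<and> b \<noteq> 0 \<and> c = a + b"
    then obtain a b where ab: "a \<bullet>\<^sub>J a = a" "a \<noteq> 0" "b \<bullet>\<^sub>J b = b" "b \<noteq> 0" "c = a + b" by blast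
    have idem: "\<And>d. d \<in> C \<Longrightarrow> d \<bullet>\<^sub>J d = d"
      and orth: "\<And>x y. x \<in> C \<Longrightarrow> y \<in> C \<Longrightarrow> x \<noteq> y \<Longrightarrow> x \<bullet>\<^sub>J y = 0"
      using C unfolding P_def by blast+
    have "a \<bullet>\<^sub>J b = 0" using idempotent_add_orthogonal[OF ab(1,3)] idem[OF c] ab(5) by metis
    then have "a \<noteq> b" using ab(1,2) by metis
    have da: "d \<bullet>\<^sub>J a = 0" "d \<bullet>\<^sub>J b = 0" if "d \<in> C - {c}" for d
    proof -
      have "d \<bullet>\<^sub>J d = d" "d \<bullet>\<^sub>J (a + b) = 0" using that idem orth[of d c] c ab(5) by auto
      then show "d \<bullet>\<^sub>J a = 0" "d \<bullet>\<^sub>J b = 0"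
        using orthogonal_summand[OF _ ab(1,3)] orthogonal_summand[OF _ ab(3,1)] by (simp_all add: add.commute)
    qed
    then have nin: "a \<notin> C - {c}" "b \<notin> C - {c}" using ab by metis+
    define D where "D = insert a (insert b (C - {c}))"
    have fin: "finite C" using C by (simp add: P_def)
    have "\<Sum>D = \<Sum>C"
      using fin nin c \<open>a \<noteq> b\<close> ab(5) by (simp add: D_def sum.remove[of C c] add.assoc)
    moreover have "x \<bullet>\<^sub>J y = 0" if "x \<in> D" "y \<in> D" "x \<noteq> y" for x y
      using that da \<open>a \<bullet>\<^sub>J b = 0\<close> orth commute unfolding D_def
      by (metis (no_types, lifting) DiffD1 insertE)
    ultimately have "P D" using C ab by (auto simp: P_def D_def)
    moreover have "card D = Suc (Suc (card (C - {c})))"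
      using fin nin \<open>a \<noteq> b\<close> by (simp add: D_def del: card_Diff_singleton card_Diff_insert)
    then have "card D = Suc (card C)" by (simp only: card.remove[OF fin c])
    ultimately show False using max[of D] by simp
  qed
  then show ?thesis using C by (auto simp: P_def jordan_frame_def)
qed

subsection \<open>Functionals of opposite sign on orthogonal idempotents\<close>

text \<open>The property of the normal \<open>a\<close> from \<open>lattice_like_normal\<close>,
  restricted to orthogonal idempotents.\<close>

definition opposite_signs :: "'a \<Rightarrow> bool" where
  "opposite_signs a \<longleftrightarrow> (\<forall>p q. p \<bullet>\<^sub>J p = p \<longrightarrow> q \<bullet>\<^sub>J q = q \<longrightarrow> p \<bullet>\<^sub>J q = 0 \<longrightarrow> (a \<bullet> p) * (a \<bullet> q) \<le> 0)"

lemma opposite_signsD: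
  "opposite_signs a \<Longrightarrow> p \<bullet>\<^sub>J p = p \<Longrightarrow> q \<bullet>\<^sub>J q = q \<Longrightarrow> p \<bullet>\<^sub>J q = 0 \<Longrightarrow> (a \<bullet> p) * (a \<bullet> q) \<le> 0"
  by (simp add: opposite_signs_def)

text \<open>Because \<open>a \<bullet> d = 0\<close>, the values of \<open>a\<close> on the rotated
  pair are, up to a positive factor, those in \<open>rotation_sign_change\<close> with
  \<open>\<alpha> = a \<bullet> c\<close> and \<open>\<beta> = a \<bullet> x\<close>.\<close>

lemma sign_linked:
  assumes sign: "opposite_signs a"
    and c: "primitive_idempotent jp c" and d: "primitive_idempotent jp d" and cd: "c \<bullet>\<^sub>J d = 0"
    and "linked c d" "a \<bullet> d = 0"
  shows "a \<bullet> c = 0"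
proof -
  have cc: "c \<bullet>\<^sub>J c = c" and dd: "d \<bullet>\<^sub>J d = d"
    using c d by (auto simp: primitive_idempotent_def idempotent_def)
  obtain x0 where x0: "x0 \<noteq> 0" "c \<bullet>\<^sub>J x0 = (1/2) *\<^sub>R x0" "d \<bullet>\<^sub>J x0 = (1/2) *\<^sub>R x0"
    using assms(5) by (auto simp: linked_def)
  obtain k where k: "(k *\<^sub>R x0) \<bullet>\<^sub>J (k *\<^sub>R x0) = c + d"
    using linked_normalized[OF c d cd x0] by metis
  define x where "x = k *\<^sub>R x0"
  have x: "c \<bullet>\<^sub>J x = (1/2) *\<^sub>R x" "d \<bullet>\<^sub>J x = (1/2) *\<^sub>R x" "x \<bullet>\<^sub>J x = c + d"
    using x0 k by (auto simp: x_def jp_linear)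
  show ?thesis
  proof (rule rotation_sign_change)
    fix s :: real
    let ?p = "c + s *\<^sub>R x + s\<^sup>2 *\<^sub>R d" and ?q = "s\<^sup>2 *\<^sub>R c - s *\<^sub>R x + d"
    let ?n = "1 / (1 + s\<^sup>2)"
    have n: "?n > 0" "(1 + s\<^sup>2) \<noteq> 0" by (auto simp: add_pos_nonneg add_nonneg_eq_0_iff)
    have "(?n *\<^sub>R ?p) \<bullet>\<^sub>J (?n *\<^sub>R ?p) = ?n *\<^sub>R ?p" "(?n *\<^sub>R ?q) \<bullet>\<^sub>J (?n *\<^sub>R ?q) = ?n *\<^sub>R ?q"
      "(?n *\<^sub>R ?p) \<bullet>\<^sub>J (?n *\<^sub>R ?q) = 0"
      unfolding jp_linear(5,6) rotated_idempotents[OF cc dd cd x] using n by simp_all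
    from opposite_signsD[OF sign this] have "(a \<bullet> ?p) * (a \<bullet> ?q) * (?n * ?n) \<le> 0"
      by (simp only: inner_scaleR_right mult_ac)
    then have "(a \<bullet> ?p) * (a \<bullet> ?q) \<le> 0"
      using n by (metis mult_pos_pos mult_le_0_iff not_less)
    then show "(a \<bullet> c + s * (a \<bullet> x)) * (s\<^sup>2 * (a \<bullet> c) - s * (a \<bullet> x)) \<le> 0"
      using assms(6) by (simp add: inner_add_right inner_diff_right)
  qed
qed

lemma linked_commute: "linked c d \<longleftrightarrow> linked d c"
  by (auto simp: linked_def)

text \<open>By \<open>sign_linked\<close> read backwards, nonvanishing spreads along links.
  Simplicity links \<open>c\<close> to some \<open>d\<close>, and then a third \<open>h\<close> to
  \<open>c\<close> or \<open>d\<close>, giving three nonzero values with pairwise nonpositive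
  products.\<close>

lemma sign_frame:
  assumes simple: "jordan_simple jp"
    and sign: "opposite_signs a"
    and C: "jordan_frame jp e C" "card C \<ge> 3" and c: "c \<in> C"
  shows "a \<bullet> c = 0"
proof (rule ccontr)
  assume ac: "a \<bullet> c \<noteq> 0"
  note F = jordan_frameD[OF C(1)]
  have transfer: "a \<bullet> d' \<noteq> 0" if "c' \<in> C" "d' \<in> C" "c' \<noteq> d'" "linked c' d'" "a \<bullet> c' \<noteq> 0" for c' d'
    using that sign_linked[OF sign F(2,2,5), of c' d'] by blast
  have third: "\<exists>h\<in>C. h \<noteq> c \<and> h \<noteq> d" for d
  proof (rule ccontr)
    assume "\<not> ?thesis"
    then have "C \<subseteq> {c, d}" by blast
    then have "card C \<le> card {c, d}" by (intro card_mono) auto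
    then show False using C(2) card_insert_le_m1[of 2 "{d}" c] by simp
  qed
  have ne: "g \<noteq> e" if "h \<in> C" "h \<bullet>\<^sub>J g = 0" for g h
    using that F(4) unit[of h] commute[of h e] by auto
  obtain h where "h \<in> C" "h \<noteq> c" using third by blast
  then have "c \<noteq> e" using ne[of h c] F(5) c by blast
  then obtain w where w: "w \<noteq> 0" "c \<bullet>\<^sub>J w = (1/2) *\<^sub>R w"
    using simple_peirce_half[OF simple] F c by blast
  then obtain d where d: "d \<in> C - {c}" "d \<bullet>\<^sub>J w \<noteq> 0"
    using frame_half_component[OF C(1), of "{c}" w] c by auto
  then have cd: "c \<bullet>\<^sub>J d = 0" using F c by auto
  have "linked c d"
    using d(2) peirce_half_component[OF _ _ cd w(2)] F c d unfolding linked_def by blast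
  then have ad: "a \<bullet> d \<noteq> 0" using transfer[of c d] ac c d by auto
  have g: "(c + d) \<bullet>\<^sub>J (c + d) = c + d"
    using orthogonal_idempotents_add F c d cd by blast
  have "c + d \<noteq> 0"
    using F(3,4)[OF c] cd jp_linear(2)[of c c d] jp_linear(10)[of c] by auto
  obtain h where "h \<in> C" "h \<noteq> c" "h \<noteq> d" using third by blast
  then have "c + d \<noteq> e" using ne[of h "c + d"] F(5) c d by (simp add: jp_linear)
  then obtain v where v: "v \<noteq> 0" "(c + d) \<bullet>\<^sub>J v = (1/2) *\<^sub>R v"
    using simple_peirce_half[OF simple g] \<open>c + d \<noteq> 0\<close> by blast
  moreover have "\<Sum>{c, d} = c + d" using d by auto
  ultimately obtain h where h: "h \<in> C" "h \<noteq> c" "h \<noteq> d" "h \<bullet>\<^sub>J v \<noteq> 0"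
    using frame_half_component[OF C(1), of "{c, d}" v] c d by auto
  then have hcd: "h \<bullet>\<^sub>J c = 0" "h \<bullet>\<^sub>J d = 0" "(c + d) \<bullet>\<^sub>J h = 0" "h \<bullet>\<^sub>J h = h"
    using F c d by (auto simp: jp_linear)
  define u where "u = h \<bullet>\<^sub>J v"
  have u: "(c + d) \<bullet>\<^sub>J u = (1/2) *\<^sub>R u" "h \<bullet>\<^sub>J u = (1/2) *\<^sub>R u" "u \<noteq> 0"
    using peirce_half_component[OF g hcd(4,3) v(2)] h by (auto simp: u_def)
  \<comment> \<open>\<open>c + d\<close> halves the nonzero vector \<open>u\<close>, so
    \<open>c\<close> and \<open>d\<close> cannot both annihilate it.\<close>
  have "c \<bullet>\<^sub>J u \<noteq> 0 \<or> d \<bullet>\<^sub>J u \<noteq> 0" using u by (auto simp: jp_linear)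
  then have "linked h c \<or> linked h d"
    using peirce_half_component[OF hcd(4) _ hcd(1) u(2)] peirce_half_component[OF hcd(4) _ hcd(2) u(2)] F c d
    unfolding linked_def by blast
  then have ah: "a \<bullet> h \<noteq> 0"
    using transfer[of c h] transfer[of d h] ac ad h c d by (auto simp: linked_commute)
  have "(a \<bullet> c) * (a \<bullet> d) \<le> 0" "(a \<bullet> h) * (a \<bullet> c) \<le> 0" "(a \<bullet> h) * (a \<bullet> d) \<le> 0"
    using opposite_signsD[OF sign] F c d h hcd cd by auto
  then show False using ac ad ah by (auto simp: mult_le_0_iff)
qed

text \<open>
  Every nonzero idempotent \<open>y\<close> with \<open>(c + d) y = y\<close> satisfies \<open>\<langle>y, c + d\<rangle> \<ge> \<langle>c, c\<rangle>\<close>, and the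
  rotated idempotent attains equality, so it cannot split.
\<close>

lemma rotated_primitive:
  assumes c: "primitive_idempotent jp c" and d: "primitive_idempotent jp d" and cd: "c \<bullet>\<^sub>J d = 0"
    and x: "c \<bullet>\<^sub>J x = (1/2) *\<^sub>R x" "d \<bullet>\<^sub>J x = (1/2) *\<^sub>R x" "x \<bullet>\<^sub>J x = c + d"
  shows "primitive_idempotent jp ((1/2) *\<^sub>R (c + x + d))"
proof -
  have cc: "c \<bullet>\<^sub>J c = c" "c \<noteq> 0" and dd: "d \<bullet>\<^sub>J d = d" "d \<noteq> 0"
    using c d by (auto simp: primitive_idempotent_def idempotent_def)
  have dc: "d \<bullet>\<^sub>J c = 0" using cd by (simp add: commute)
  define \<kappa> where "\<kappa> = c \<bullet> c"
  define g where "g = c + d"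
  have "c \<bullet> d = 0" using inner_assoc[of c c d] cc cd by simp
  have "\<kappa> > 0" using cc by (simp add: \<kappa>_def)
  have orth: "c \<bullet> w = 0" "d \<bullet> w = 0"
    if "c \<bullet>\<^sub>J w = (1/2) *\<^sub>R w" "d \<bullet>\<^sub>J w = (1/2) *\<^sub>R w" for w
    using inner_assoc[of c c w] inner_assoc[of d d w] cc dd that by auto
  have "x \<noteq> 0" using x(3) inner_assoc[of c c "c + d"] cc cd by (auto simp: jp_linear)
  have "d \<bullet> d = \<kappa>"
  proof -
    obtain l where l: "l * (c \<bullet> c) = (x \<bullet> x) / 2" "l * (d \<bullet> d) = (x \<bullet> x) / 2"
      using off_diagonal_square[OF c d cd x(1,2)] by metis
    have "l \<noteq> 0" using l(1) \<open>x \<noteq> 0\<close> by auto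
    moreover have "l * (c \<bullet> c) = l * (d \<bullet> d)" by (simp only: l)
    ultimately show ?thesis by (simp add: \<kappa>_def)
  qed
  have low: "\<kappa> \<le> y \<bullet> g" if y: "y \<bullet>\<^sub>J y = y" "y \<noteq> 0" "g \<bullet>\<^sub>J y = y" for y
  proof -
    obtain \<alpha> where \<alpha>: "peirce1 c y = \<alpha> *\<^sub>R c"
      using primitive_idempotent_peirce_one[OF c peirce1[OF cc(1)]] by metis
    obtain \<beta> where \<beta>: "peirce1 d y = \<beta> *\<^sub>R d"
      using primitive_idempotent_peirce_one[OF d peirce1[OF dd(1)]] by metis
    define w where "w = peirceh c y"
    have dy: "d \<bullet>\<^sub>J y = y - c \<bullet>\<^sub>J y" using y(3) by (simp add: g_def jp_linear algebra_simps)
    \<comment> \<open>On \<open>y\<close>, multiplication by \<open>d\<close> is the identity minus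
      multiplication by \<open>c\<close>, and \<open>k - k^2\<close> is unchanged when
      \<open>k\<close> becomes \<open>1 - k\<close>. So the half components for \<open>c\<close> and
      \<open>d\<close> agree.\<close>
    have "d \<bullet>\<^sub>J y - d \<bullet>\<^sub>J (d \<bullet>\<^sub>J y) = c \<bullet>\<^sub>J y - c \<bullet>\<^sub>J (c \<bullet>\<^sub>J y)"
      using orthogonal_idempotents_commute[OF cc(1) dc, of y] by (simp add: dy jp_linear)
    then have wd: "w = peirceh d y" by (simp add: w_def peirceh_def)
    have w: "c \<bullet>\<^sub>J w = (1/2) *\<^sub>R w" "d \<bullet>\<^sub>J w = (1/2) *\<^sub>R w"
      using peirceh[OF cc(1), of y] peirceh[OF dd(1), of y] wd by (simp_all add: w_def)
    have "c \<bullet>\<^sub>J y + d \<bullet>\<^sub>J y = \<alpha> *\<^sub>R c + \<beta> *\<^sub>R d + ((1/2) *\<^sub>R w + (1/2) *\<^sub>R w)"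
      unfolding peirce_sum[of c y] peirce_sum[of d y] \<alpha> \<beta> wd[symmetric] w_def[symmetric] by simp
    then have y_eq: "y = \<alpha> *\<^sub>R c + \<beta> *\<^sub>R d + w"
      using dy by (simp flip: scaleR_left_distrib)
    obtain l where l: "w \<bullet>\<^sub>J w = l *\<^sub>R (c + d)" "l * (c \<bullet> c) = (w \<bullet> w) / 2"
      using off_diagonal_square[OF c d cd w] by metis
    have yy: "y \<bullet>\<^sub>J y = (\<alpha>\<^sup>2 + l) *\<^sub>R c + (\<beta>\<^sup>2 + l) *\<^sub>R d + (\<alpha> + \<beta>) *\<^sub>R w"
      using cc dd cd dc w
      by (simp add: y_eq jp_linear l commute[of w c] commute[of w d] power2_eq_square scaleR_half_add algebra_simps)
    have "(y \<bullet>\<^sub>J y) \<bullet> c = (\<alpha>\<^sup>2 + l) * \<kappa>" "(y \<bullet>\<^sub>J y) \<bullet> d = (\<beta>\<^sup>2 + l) * \<kappa>" "y \<bullet> c = \<alpha> * \<kappa>" "y \<bullet> d = \<beta> * \<kappa>"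
      using orth[OF w] \<open>c \<bullet> d = 0\<close> \<open>d \<bullet> d = \<kappa>\<close> unfolding yy
      by (simp_all add: y_eq inner_add_left inner_commute[of w] inner_commute[of d c] \<kappa>_def)
    then have "(\<alpha>\<^sup>2 + l) * \<kappa> = \<alpha> * \<kappa>" "(\<beta>\<^sup>2 + l) * \<kappa> = \<beta> * \<kappa>" and yg: "y \<bullet> g = (\<alpha> + \<beta>) * \<kappa>"
      using y(1) by (simp_all add: g_def inner_add_right distrib_right)
    then have \<alpha>l: "\<alpha>\<^sup>2 + l = \<alpha>" and \<beta>l: "\<beta>\<^sup>2 + l = \<beta>"
      using \<open>\<kappa> > 0\<close> by (simp_all only: mult_cancel_right) auto
    \<comment> \<open>Without an off-diagonal part both coefficients are \<open>0\<close> or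
      \<open>1\<close>, not both \<open>0\<close>; with one, comparing its coefficient in the square
      forces \<open>\<alpha> + \<beta> = 1\<close>.\<close>
    have "1 \<le> \<alpha> + \<beta>"
    proof (cases "w = 0")
      case True
      then have "l = 0" using l(2) cc by simp
      then have "\<alpha> = 0 \<or> \<alpha> = 1" "\<beta> = 0 \<or> \<beta> = 1"
        using \<alpha>l \<beta>l by (auto simp: power2_eq_square)
      then show ?thesis using y(2) True by (auto simp: y_eq)
    next
      case False
      have "(\<alpha> + \<beta>) *\<^sub>R w = 1 *\<^sub>R w"
        using yy unfolding y(1) \<alpha>l \<beta>l by (simp add: y_eq)
      then show ?thesis using False by (simp only: scaleR_cancel_right) simp
    qed
    then show ?thesis using \<open>\<kappa> > 0\<close> by (simp add: yg mult_le_cancel_right1)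
  qed
  define p where "p = (1/2) *\<^sub>R (c + x + d)"
  define q where "q = (1/2) *\<^sub>R (c - x + d)"
  have pq: "p \<bullet>\<^sub>J p = p" "q \<bullet>\<^sub>J q = q" "p \<bullet>\<^sub>J q = 0"
    using rotated_idempotents[OF cc(1) dd(1) cd x, of 1] by (simp_all add: p_def q_def jp_linear(5,6))
  have "p + q = g"
    by (simp add: p_def q_def g_def flip: scaleR_add_right)
  have "p \<bullet> g = \<kappa>"
    using orth[OF x(1,2)] \<open>c \<bullet> d = 0\<close> \<open>d \<bullet> d = \<kappa>\<close>
    by (simp add: p_def g_def inner_add inner_commute \<kappa>_def)
  show ?thesis
    unfolding primitive_idempotent_def idempotent_def p_def[symmetric]
  proof (intro conjI notI)
    show "p \<bullet>\<^sub>J p = p" by (rule pq)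
    show "p = 0 \<Longrightarrow> False" using \<open>p \<bullet> g = \<kappa>\<close> \<open>\<kappa> > 0\<close> by simp
    assume "\<exists>a b. a \<bullet>\<^sub>J a = a \<and> a \<noteq> 0 \<and> b \<bullet>\<^sub>J b = b \<and> b \<noteq> 0 \<and> p = a + b"
    then obtain a b where ab: "a \<bullet>\<^sub>J a = a" "a \<noteq> 0" "b \<bullet>\<^sub>J b = b" "b \<noteq> 0" "p = a + b" by blast
    have "a \<bullet>\<^sub>J b = 0" using idempotent_add_orthogonal ab pq by simp
    moreover have "q \<bullet>\<^sub>J a = 0" "q \<bullet>\<^sub>J b = 0"
      using orthogonal_summand[of q a b] orthogonal_summand[of q b a] ab pq commute[of q p]
      by (simp_all add: add.commute)
    ultimately have "g \<bullet>\<^sub>J a = a" "g \<bullet>\<^sub>J b = b"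
      using ab commute[of b a] unfolding \<open>p + q = g\<close>[symmetric] by (simp_all add: jp_linear)
    then have "\<kappa> \<le> a \<bullet> g" "\<kappa> \<le> b \<bullet> g" using low ab by auto
    then show False
      using \<open>p \<bullet> g = \<kappa>\<close> \<open>\<kappa> > 0\<close> by (simp add: ab(5) inner_add_left)
  qed
qed

text \<open>Rotating \<open>c\<close>, \<open>d\<close> by 45 degrees gives a frame of the same size
  containing \<open>(c + y + d) / 2\<close>, where \<open>y\<close> is a normalized multiple of
  \<open>x\<close>. As \<open>a\<close> vanishes on this element and on \<open>c\<close> and
  \<open>d\<close>, it vanishes on \<open>x\<close>.\<close>

lemma sign_off_diagonal:
  assumes simple: "jordan_simple jp"
    and sign: "opposite_signs a"
    and C: "jordan_frame jp e C" "card C \<ge> 3" and cd: "c \<in> C" "d \<in> C" "c \<noteq> d"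
    and x: "c \<bullet>\<^sub>J x = (1/2) *\<^sub>R x" "d \<bullet>\<^sub>J x = (1/2) *\<^sub>R x"
  shows "a \<bullet> x = 0"
proof (cases "x = 0")
  case False
  note F = jordan_frameD[OF C(1)]
  have prim: "primitive_idempotent jp c" "primitive_idempotent jp d" "c \<bullet>\<^sub>J d = 0"
    using F cd by auto
  obtain k where k: "k \<noteq> 0" "(k *\<^sub>R x) \<bullet>\<^sub>J (k *\<^sub>R x) = c + d"
    using linked_normalized[OF prim False x] by metis
  define y where "y = k *\<^sub>R x"
  have y: "c \<bullet>\<^sub>J y = (1/2) *\<^sub>R y" "d \<bullet>\<^sub>J y = (1/2) *\<^sub>R y" "y \<bullet>\<^sub>J y = c + d"
    using x k by (auto simp: y_def jp_linear)
  then have y': "c \<bullet>\<^sub>J (- y) = (1/2) *\<^sub>R (- y)" "d \<bullet>\<^sub>J (- y) = (1/2) *\<^sub>R (- y)" "(- y) \<bullet>\<^sub>J (- y) = c + d"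
    by (simp_all add: jp_linear)
  define p where "p = (1/2) *\<^sub>R (c + y + d)"
  define q where "q = (1/2) *\<^sub>R (c - y + d)"
  have primpq: "primitive_idempotent jp p" "primitive_idempotent jp q"
    using rotated_primitive[OF prim y] rotated_primitive[OF prim y'] by (simp_all add: p_def q_def)
  then have pp: "p \<bullet>\<^sub>J p = p" "q \<bullet>\<^sub>J q = q" "p \<noteq> 0" "q \<noteq> 0"
    by (auto simp: primitive_idempotent_def idempotent_def)
  have pq: "p \<bullet>\<^sub>J q = 0"
    using rotated_idempotents(3)[OF F(3)[OF cd(1)] F(3)[OF cd(2)] prim(3) y, of 1]
    by (simp add: p_def q_def jp_linear(5,6))
  have "p + q = c + d"
    by (simp add: p_def q_def flip: scaleR_add_right)
  have h: "p \<bullet>\<^sub>J h = 0" "q \<bullet>\<^sub>J h = 0" if "h \<in> C - {c, d}" for h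
  proof -
    have ch: "c \<bullet>\<^sub>J h = 0" "d \<bullet>\<^sub>J h = 0" using that F(5) cd by auto
    have "(c + d) \<bullet>\<^sub>J y = y" using y by (simp add: jp_linear flip: scaleR_left_distrib)
    moreover have "(c + d) \<bullet>\<^sub>J h = 0" using ch by (simp add: jp_linear)
    ultimately have "y \<bullet>\<^sub>J h = 0"
      by (rule peirce_one_zero[OF orthogonal_idempotents_add[OF F(3)[OF cd(1)] F(3)[OF cd(2)] prim(3)]])
    then show "p \<bullet>\<^sub>J h = 0" "q \<bullet>\<^sub>J h = 0" using ch by (simp_all add: p_def q_def jp_linear)
  qed
  \<comment> \<open>Membership would make \<open>p\<close> or \<open>q\<close> orthogonal to itself,
    hence zero.\<close>
  have nin: "p \<notin> C - {c, d}" "q \<notin> C - {c, d}" using h(1)[of p] h(2)[of q] pp by auto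
  have "p \<noteq> q" using pq pp by auto
  define D where "D = insert p (insert q (C - {c, d}))"
  have Ccd: "C = insert c (insert d (C - {c, d}))" using cd by auto
  have fin: "finite (C - {c, d})" using F by auto
  have "\<Sum>(insert c (insert d (C - {c, d}))) = c + (d + \<Sum>(C - {c, d}))"
    using cd fin by simp
  moreover have "\<Sum>D = p + (q + \<Sum>(C - {c, d}))"
    using nin fin \<open>p \<noteq> q\<close> by (simp add: D_def)
  ultimately have "\<Sum>D = e"
    using F(6) \<open>p + q = c + d\<close> unfolding Ccd[symmetric] by (simp add: add.assoc[symmetric])
  moreover have "u \<bullet>\<^sub>J v = 0" if "u \<in> D" "v \<in> D" "u \<noteq> v" for u v
    using that h pq commute F(5) unfolding D_def
    by (metis (no_types, lifting) DiffD1 insertE)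
  moreover have "\<forall>u\<in>D. primitive_idempotent jp u" using primpq F by (auto simp: D_def)
  ultimately have "jordan_frame jp e D" using fin by (auto simp: jordan_frame_def D_def)
  moreover have "card D = card C"
  proof -
    have "card (insert c (insert d (C - {c, d}))) = Suc (Suc (card (C - {c, d})))"
      "card D = Suc (Suc (card (C - {c, d})))"
      using cd nin fin \<open>p \<noteq> q\<close>
      by (simp_all add: D_def del: card_Diff_singleton card_Diff_insert insert_Diff_single)
    then show ?thesis unfolding Ccd[symmetric] by simp
  qed
  ultimately have "a \<bullet> p = 0"
    using sign_frame[OF simple sign, of D p] C(2) by (simp add: D_def)
  moreover have "a \<bullet> c = 0" "a \<bullet> d = 0"
    using sign_frame[OF simple sign C] cd by auto
  ultimately show ?thesis using k by (simp add: p_def y_def inner_add_right)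
qed simp

theorem sign_functional_eq_0:
  assumes simple: "jordan_simple jp" and rank: "jordan_rank jp e \<ge> 3"
    and sign: "opposite_signs a"
  shows "a = 0"
proof -
  define C where "C = (SOME C. jordan_frame jp e C)"
  have C: "jordan_frame jp e C" "card C \<ge> 3"
    using someI_ex[OF exists_jordan_frame] rank by (auto simp: C_def jordan_rank_def)
  note F = jordan_frameD[OF C(1)]
  have "a \<bullet> v = 0" for v
  proof -
    have "a \<bullet> (c \<bullet>\<^sub>J v) = 0" if c: "c \<in> C" for c
    proof -
      obtain k where k: "peirce1 c v = k *\<^sub>R c"
        using primitive_idempotent_peirce_one[OF F(2)[OF c] peirce1[OF F(3)[OF c]]] by metis
      define w where "w = peirceh c v"
      have w: "c \<bullet>\<^sub>J w = (1/2) *\<^sub>R w" using peirceh[OF F(3)[OF c]] by (simp add: w_def)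
      have "a \<bullet> (d \<bullet>\<^sub>J w) = 0" if d: "d \<in> C - {c}" for d
      proof -
        have cd: "c \<bullet>\<^sub>J d = 0" using F(5) c d by auto
        show ?thesis
          using sign_off_diagonal[OF simple sign C c] d F(3)
            peirce_half_component[OF F(3)[OF c] _ cd w] by auto
      qed
      then have "a \<bullet> (\<Sum>d\<in>C - {c}. d \<bullet>\<^sub>J w) = 0"
        by (simp add: inner_sum_right)
      \<comment> \<open>The summands lie in joint Peirce spaces, where \<open>a\<close> vanishes, so
        \<open>a \<bullet> w\<close> equals its own half.\<close>
      moreover have "w = (1/2) *\<^sub>R w + (\<Sum>d\<in>C - {c}. d \<bullet>\<^sub>J w)"
        using jordan_frame_sum[OF C(1), of w] sum.remove[OF F(1) c, of "\<lambda>d. d \<bullet>\<^sub>J w"] w by simp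
      ultimately have "a \<bullet> w = (1/2) * (a \<bullet> w)"
        by (metis add.right_neutral inner_add_right inner_scaleR_right)
      then have "a \<bullet> w = 0" by simp
      then show ?thesis
        using sign_frame[OF simple sign C c] by (simp add: peirce_sum[of c v] k inner_add_right w_def)
    qed
    then show ?thesis
      by (subst jordan_frame_sum[OF C(1), of v]) (simp add: inner_sum_right)
  qed
  then show ?thesis by (metis inner_eq_zero_iff)
qed

section \<open>Lattice-like sets for the two cones\<close>

lemma cone_cone_of_squares: "cone (cone_of_squares jp)"
  unfolding cone_def cone_of_squares_def
proof safe
  fix t :: real and x assume "0 \<le> t"
  then have "t *\<^sub>R (x \<bullet>\<^sub>J x) = (sqrt t *\<^sub>R x) \<bullet>\<^sub>J (sqrt t *\<^sub>R x)" by (simp add: jp_linear)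
  then show "t *\<^sub>R (x \<bullet>\<^sub>J x) \<in> range (\<lambda>x. x \<bullet>\<^sub>J x)" by blast
qed

theorem no_proper_lattice_like:
  assumes simple: "jordan_simple jp" and rank: "jordan_rank jp e \<ge> 3"
    and M: "closed M" "convex M" "lattice_like (cone_of_squares jp) M" "interior M \<noteq> {}"
  shows "M = UNIV"
proof (rule ccontr)
  assume "M \<noteq> UNIV"
  moreover have "top_of_set UNIV interior_of M \<noteq> {}" using M(4) by simp
  ultimately obtain a where "a \<noteq> 0"
    and a: "\<And>u v. \<lbrakk>u \<in> cone_of_squares jp; v \<in> cone_of_squares jp; u \<bullet> v = 0;
        \<And>w. w \<in> cone_of_squares jp \<Longrightarrow> 0 \<le> w \<bullet> u; \<And>w. w \<in> cone_of_squares jp \<Longrightarrow> 0 \<le> w \<bullet> v\<rbrakk>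
      \<Longrightarrow> (a \<bullet> u) * (a \<bullet> v) \<le> 0"
    using lattice_like_normal[OF subspace_UNIV subset_UNIV _ M(1,2) _ subset_UNIV cone_cone_of_squares M(3)]
    by metis
  \<comment> \<open>Idempotents lie in the dual cone because multiplication by them is positive
    semidefinite.\<close>
  have nonneg: "0 \<le> w \<bullet> p" if p: "p \<bullet>\<^sub>J p = p" and w: "w \<in> cone_of_squares jp" for w p
  proof -
    obtain y where "w = y \<bullet>\<^sub>J y" using w by (auto simp: cone_of_squares_def)
    then show ?thesis
      using inner_idempotent_nonneg[OF p, of y] inner_assoc[of y y p]
      by (simp add: commute[of y p] inner_commute)
  qed
  have "a = 0"
  proof (intro sign_functional_eq_0[OF simple rank] opposite_signs_def[THEN iffD2] allI impI)
    fix p q assume pq: "p \<bullet>\<^sub>J p = p" "q \<bullet>\<^sub>J q = q" "p \<bullet>\<^sub>J q = 0"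
    then have "p \<bullet> q = 0" using inner_assoc[of p p q] by simp
    moreover have "p \<in> cone_of_squares jp" "q \<in> cone_of_squares jp"
      using pq by (auto simp: cone_of_squares_def intro: range_eqI[OF sym])
    ultimately show "(a \<bullet> p) * (a \<bullet> q) \<le> 0" using a nonneg pq by blast
  qed
  then show False using \<open>a \<noteq> 0\<close> by simp
qed

end

text \<open>The locale takes a whole type as its algebra, while the symmetric matrices form a
  subspace of one; so the argument runs through rank-one matrices and quadratic forms.\<close>

lemma no_proper_lattice_like_sym_matrices:
  fixes M :: "(real ^ 'n ^ 'n) set"
  assumes "CARD('n) \<ge> 3" and "M \<subseteq> sym_matrices" "closed M" "convex M"
    and "lattice_like psd_matrices M" "top_of_set sym_matrices interior_of M \<noteq> {}"
  shows "M = sym_matrices"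
proof (rule ccontr)
  assume "M \<noteq> sym_matrices"
  moreover have "psd_matrices \<subseteq> sym_matrices" by (auto simp: psd_matrices_def)
  ultimately obtain A :: "real ^ 'n ^ 'n" where A: "A \<in> sym_matrices" "A \<noteq> 0"
    and sign: "\<And>u v. \<lbrakk>u \<in> psd_matrices; v \<in> psd_matrices; u \<bullet> v = 0;
        \<And>w. w \<in> psd_matrices \<Longrightarrow> 0 \<le> w \<bullet> u; \<And>w. w \<in> psd_matrices \<Longrightarrow> 0 \<le> w \<bullet> v\<rbrakk>
      \<Longrightarrow> (A \<bullet> u) * (A \<bullet> v) \<le> 0"
    using lattice_like_normal[OF subspace_sym_matrices assms(2) _ assms(3,4,6) _ cone_psd_matrices assms(5)]
    by metis
  have nonneg: "0 \<le> w \<bullet> outer x" if "w \<in> psd_matrices" for w and x :: "real ^ 'n"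
    using that by (simp add: psd_matrices_def inner_outer)
  have "(x \<bullet> (A *v x)) * (y \<bullet> (A *v y)) \<le> 0" if "x \<bullet> y = 0" for x y
    unfolding inner_outer[symmetric]
    by (intro sign outer_psd nonneg) (simp add: inner_outer_outer that)
  then have "A = 0" by (rule sym_matrix_eq_0[OF A(1) assms(1)])
  then show False using A by simp
qed

theorem corollary6:
  shows "(\<forall>(jp :: 'a::euclidean_space \<Rightarrow> 'a \<Rightarrow> 'a) e.
            euclidean_jordan_algebra jp e \<and> jordan_simple jp \<and> jordan_rank jp e \<ge> 3 \<longrightarrow>
            \<not> (\<exists>M. M \<noteq> UNIV \<and> closed M \<and> convex M \<and>
                    lattice_like (cone_of_squares jp) M \<and> interior M \<noteq> {}))
       \<and> (CARD('n::finite) \<ge> 3 \<longrightarrow>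
            \<not> (\<exists>M :: (real ^ 'n ^ 'n) set.
                    M \<subseteq> sym_matrices \<and> M \<noteq> sym_matrices \<and> closed M \<and> convex M \<and>
                    lattice_like psd_matrices M \<and>
                    top_of_set sym_matrices interior_of M \<noteq> {}))"
proof (intro conjI allI impI notI)
  fix jp :: "'a \<Rightarrow> 'a \<Rightarrow> 'a" and e
  assume "euclidean_jordan_algebra jp e \<and> jordan_simple jp \<and> jordan_rank jp e \<ge> 3"
    and "\<exists>M. M \<noteq> UNIV \<and> closed M \<and> convex M \<and>
           lattice_like (cone_of_squares jp) M \<and> interior M \<noteq> {}"
  then show False
    using euclidean_jordan_algebra.no_proper_lattice_like by blast
next
  assume "CARD('n) \<ge> 3"
    and "\<exists>M :: (real ^ 'n ^ 'n) set.
           M \<subseteq> sym_matrices \<and> M \<noteq> sym_matrices \<and> closed M \<and> convex M \<and>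
           lattice_like psd_matrices M \<and> top_of_set sym_matrices interior_of M \<noteq> {}"
  then show False
    using no_proper_lattice_like_sym_matrices by blast
qed

end
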